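(* Let $k\ge 0$ be an integer and let $f\colon X\to Y$ be a $k$-dimensional map between $C$-compacta. Then for any open cover $\omega_X$ of $X$ and any open cover $\omega_Y$ of $Y$ there exist compact polyhedra $|\mathcal K|$ and $|\mathcal L|$, an $\omega_X$-map $\kappa_X\colon X\to|\mathcal K|$, an $\omega_Y$-map $\kappa_Y\colon Y\to|\mathcal L|$, and a $k$-dimensional simplicial map $p\colon|\mathcal K|\to|\mathcal L|$ such that $p\circ\kappa_X=\kappa_Y\circ f$. Furthermore, these can always be chosen so that $\dim|\mathcal L|\le\dim Y$ and $\dim|\mathcal K|\le\dim Y+k$.
   Context: All spaces are separable metrizable; a map is a continuous function; a compactum is a compact (metrizable) space; $\dim$ is covering dimension (possibly $\infty$). A space $X$ is a $C$-space if for any sequence $\{\alpha_n:n\in\mathbb N\}$ of open covers of $X$ there exists a sequence $\{\mu_n:n\in\mathbb N\}$ of disjoint families of open sets such that each $\mu_n$ refines $\alpha_n$ and the union of all the families $\mu_n$ covers $X$. A $C$-compactum is a compact $C$-space. A map is $k$-dimensional (has dimension at most $k$, $\dim f\le k$) if each of its fibers has dimension at most $k$. For a simplicial complex $\mathcal K$, $|\mathcal K|$ is the corresponding polyhedron; a simplicial map $|\mathcal K|\to|\mathcal L|$ is a map sending simplices to simplices and affine on each of them. For an open cover $\omega$ of $X$, a map $\kappa\colon X\to Z$ is an $\omega$-map if $Z$ has an open cover such that the preimage of each of its members is contained in some member of $\omega$. *)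

theory Defs
  imports "HOL-Analysis.Analysis" "HOL-Analysis.Finite_Function_Topology"
begin

subsection \<open>Covers, C-spaces and covering dimension\<close>

definition open_cover :: "'a topology \<Rightarrow> 'a set set \<Rightarrow> bool" where
  "open_cover X \<U> \<longleftrightarrow> (\<forall>U\<in>\<U>. openin X U) \<and> \<Union>\<U> = topspace X"

definition cover_refines :: "'a set set \<Rightarrow> 'a set set \<Rightarrow> bool" where
  "cover_refines \<V> \<U> \<longleftrightarrow> (\<forall>V\<in>\<V>. \<exists>U\<in>\<U>. V \<subseteq> U)"

definition C_space :: "'a topology \<Rightarrow> bool" where
  "C_space X \<longleftrightarrow>
     (\<forall>\<alpha> :: nat \<Rightarrow> 'a set set. (\<forall>n. open_cover X (\<alpha> n)) \<longrightarrow>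
        (\<exists>\<mu> :: nat \<Rightarrow> 'a set set.
           (\<forall>n. (\<forall>U\<in>\<mu> n. openin X U) \<and> disjoint (\<mu> n) \<and> cover_refines (\<mu> n) (\<alpha> n)) \<and>
           open_cover X (\<Union>n. \<mu> n)))"

text \<open>Compact metrizable spaces are automatically separable.\<close>

definition C_compactum :: "'a topology \<Rightarrow> bool" where
  "C_compactum X \<longleftrightarrow> metrizable_space X \<and> compact_space X \<and> C_space X"

definition covering_dim_le :: "'a topology \<Rightarrow> int \<Rightarrow> bool" where
  "covering_dim_le X n \<longleftrightarrow>
     (\<forall>\<U>. finite \<U> \<and> open_cover X \<U> \<longrightarrow>
        (\<exists>\<V>. finite \<V> \<and> open_cover X \<V> \<and> cover_refines \<V> \<U> \<and>
             (\<forall>x\<in>topspace X. int (card {V\<in>\<V>. x \<in> V}) \<le> n + 1)))"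

text \<open>The value is $-1$ exactly for the empty space, and $\infty$ (the infimum of the empty set)
  if no integer bound holds.\<close>

definition covering_dim :: "'a topology \<Rightarrow> ereal" where
  "covering_dim X = Inf {ereal (of_int n) | n. -1 \<le> n \<and> covering_dim_le X n}"

definition dimensional_map :: "nat \<Rightarrow> 'a topology \<Rightarrow> 'b topology \<Rightarrow> ('a \<Rightarrow> 'b) \<Rightarrow> bool" where
  "dimensional_map k X Y f \<longleftrightarrow>
     continuous_map X Y f \<and>
     (\<forall>y\<in>topspace Y.
        covering_dim (subtopology X {x \<in> topspace X. f x = y}) \<le> ereal (real k))"

definition cover_map :: "'a set set \<Rightarrow> 'a topology \<Rightarrow> 'b topology \<Rightarrow> ('a \<Rightarrow> 'b) \<Rightarrow> bool" where
  "cover_map \<omega> X Z \<kappa> \<longleftrightarrow>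
     continuous_map X Z \<kappa> \<and>
     (\<exists>\<V>. open_cover Z \<V> \<and> (\<forall>V\<in>\<V>. \<exists>W\<in>\<omega>. {x \<in> topspace X. \<kappa> x \<in> V} \<subseteq> W))"

subsection \<open>Finite simplicial complexes\<close>

text \<open>The library predicate \<^term>\<open>simplicial_complex\<close> is restricted to a Euclidean space whose
  dimension is fixed by its type. As the number of vertices is not bounded in advance, the same
  definition is given here for an arbitrary normed space; it will be used in
  \<^typ>\<open>nat \<Rightarrow>\<^sub>0 real\<close>, which contains a copy of every finite-dimensional Euclidean space.
  Finiteness of the vertex set has to be required explicitly, since infinite affinely independent
  sets exist there. As in the library, the empty simplex is a face of every simplex.\<close>

definition finite_complex :: "'v::real_normed_vector set set \<Rightarrow> bool" where
  "finite_complex K \<longleftrightarrow>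
     finite K \<and>
     (\<forall>S\<in>K. \<exists>C. finite C \<and> \<not> affine_dependent C \<and> S = convex hull C) \<and>
     (\<forall>S\<in>K. \<forall>F. F face_of S \<longrightarrow> F \<in> K) \<and>
     (\<forall>S\<in>K. \<forall>T\<in>K. (S \<inter> T) face_of S)"

definition polyhedron_of :: "'v::real_normed_vector set set \<Rightarrow> 'v topology" where
  "polyhedron_of K = top_of_set (\<Union>K)"

definition simplicial_map_on ::
    "'v::real_normed_vector set set \<Rightarrow> 'w::real_normed_vector set set \<Rightarrow> ('v \<Rightarrow> 'w) \<Rightarrow> bool" where
  "simplicial_map_on K L p \<longleftrightarrow>
     (\<forall>S\<in>K. p ` S \<in> L \<and>
        (\<forall>x\<in>S. \<forall>y\<in>S. \<forall>t\<in>{0..1::real}.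
           p ((1 - t) *\<^sub>R x + t *\<^sub>R y) = (1 - t) *\<^sub>R p x + t *\<^sub>R p y))"

end

theory Submission
  imports Defs
begin

text \<open>Fix a metric on \<open>X\<close>. Call a subset fine if it splits into pieces of small diameter that lie at a
positive distance from one another (\<open>chain_fine\<close>). The theorem follows from one fact about
\<open>f\<close>: there are open sets \<open>G 0, \<dots>, G k\<close> covering \<open>X\<close> and an open cover of \<open>Y\<close> such that over
each member of that cover every \<open>G i\<close> is fine (\<open>fine_decomposition\<close>).

To factor \<open>f\<close> with these sets, take a partition of unity \<open>\<phi>\<close> on \<open>Y\<close> whose supports are small
and have the order allowed by \<open>dim Y\<close>, and a partition of unity \<open>b 0, \<dots>, b k\<close> on \<open>X\<close>
subordinate to the \<open>G i\<close>. At a point \<open>x\<close>, divide the unit interval into consecutive intervals of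
lengths \<open>\<phi> v (f x)\<close>, and again into consecutive intervals of lengths \<open>b i x\<close>. The lengths of the
intersections form a partition of unity indexed by pairs \<open>(v, i)\<close>; its sums over \<open>i\<close> are the
functions \<open>\<phi> v (f x)\<close>, and the pairs with a positive length form a chain, so that their number
exceeds the number of positive \<open>\<phi> v (f x)\<close> by at most \<open>k\<close>. (These are the barycentric coordinates
for the standard triangulation of the product of the nerve of \<open>\<phi>\<close> with a \<open>k\<close>-simplex.) The
set on which one of these functions is positive is fine, hence is a disjoint union of finitely many small open
sets, and the function is the sum of its restrictions to them. The nerve of the resulting partition
of unity is \<open>K\<close>, the nerve of \<open>\<phi>\<close> is \<open>L\<close>, and \<open>p\<close> forgets everything but \<open>v\<close>. Each simplex of
\<open>K\<close> has at most \<open>k\<close> vertices more than its image, which bounds both the dimension of \<open>K\<close> and that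
of the fibres of \<open>p\<close>.

The sets \<open>G i\<close> exist near each single fibre, at every scale, because the fibre has dimension at
most \<open>k\<close>. The local choices can be glued because the union of a fine set and of a second one whose
pieces are much smaller than the gaps of the first is fine again (\<open>chain_fine_Un\<close>). Gluing
therefore needs local decompositions at smaller and smaller scales, where each scale depends on the
gaps of the preceding one; and this is where \<open>Y\<close> has to be a C-space. Let \<open>\<alpha> n\<close> be a cover of \<open>Y\<close>
by sets over which there are decompositions of the \<open>n\<close>-th scale. Disjoint families refining the
\<open>\<alpha> n\<close> cover \<open>Y\<close>, and over a point of \<open>Y\<close> at most one decomposition of each scale is then in use.

The dimensions of \<open>K\<close>, \<open>L\<close> and of the fibres of \<open>p\<close> are bounded from above by the same means: a
compact metric space has covering dimension at most \<open>k\<close> if and only if it is, at every scale, the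
union of \<open>k + 1\<close> fine sets, and this property passes to finite unions. The part of a fibre of \<open>p\<close>
in one simplex is parametrized by \<open>k\<close> coordinates, and is cut up by \<open>k + 1\<close> shifted grids.\<close>

section \<open>Sets that split into small separated pieces\<close>

definition links :: "('a \<Rightarrow> 'a \<Rightarrow> real) \<Rightarrow> real \<Rightarrow> 'a set \<Rightarrow> ('a \<times> 'a) set" where
  "links d r S = {(x, y). x \<in> S \<and> y \<in> S \<and> d x y < r}"

text \<open>For a metric \<open>d\<close> and positive \<open>r\<close> this means that \<open>S\<close> is partitioned into sets of diameter at most \<open>e\<close> any two of which have distance
at least \<open>r\<close>. The formulation by chains needs no choice of a partition, which makes unions
manageable.\<close>

definition chain_fine :: "('a \<Rightarrow> 'a \<Rightarrow> real) \<Rightarrow> real \<Rightarrow> real \<Rightarrow> 'a set \<Rightarrow> bool" where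
  "chain_fine d r e S \<longleftrightarrow> (\<forall>x\<in>S. \<forall>y. (x, y) \<in> (links d r S)\<^sup>* \<longrightarrow> d x y \<le> e)"

text \<open>For compact metric spaces this is covering dimension at most \<open>k\<close>; unlike that notion it is about
arbitrary subsets and stable under finite unions for an elementary reason.\<close>

definition fine_dim_le :: "('a \<Rightarrow> 'a \<Rightarrow> real) \<Rightarrow> nat \<Rightarrow> 'a set \<Rightarrow> bool" where
  "fine_dim_le d k A \<longleftrightarrow>
     (\<forall>e>0. \<exists>r>0. \<exists>B. A \<subseteq> (\<Union>i\<le>k. B i) \<and> (\<forall>i\<le>k. B i \<subseteq> A \<and> chain_fine d r e (B i)))"

lemma chain_fineD: "chain_fine d r e S \<Longrightarrow> x \<in> S \<Longrightarrow> (x, y) \<in> (links d r S)\<^sup>* \<Longrightarrow> d x y \<le> e"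
  by (auto simp: chain_fine_def)

lemma links_mono: "S \<subseteq> T \<Longrightarrow> r \<le> r' \<Longrightarrow> links d r S \<subseteq> links d r' T"
  by (auto simp: links_def)

lemma chain_fine_mono:
  assumes "chain_fine d r e T" "S \<subseteq> T" "r' \<le> r" "e \<le> e'"
  shows "chain_fine d r' e' S"
proof -
  have "(links d r' S)\<^sup>* \<subseteq> (links d r T)\<^sup>*"
    by (intro rtrancl_mono links_mono assms)
  then show ?thesis
    using assms unfolding chain_fine_def by (meson order_trans subsetD)
qed

lemma chain_fine_empty [simp]: "chain_fine d r e {}"
  by (simp add: chain_fine_def)

lemma chain_target: "(x, y) \<in> (links d r S)\<^sup>* \<Longrightarrow> x \<in> S \<Longrightarrow> y \<in> S"
  by (induction rule: rtrancl_induct) (auto simp: links_def)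

text \<open>A label that does not change along short steps does not change along chains.\<close>

lemma chain_fine_label:
  assumes "\<And>x y. x \<in> S \<Longrightarrow> y \<in> S \<Longrightarrow> d x y < r \<Longrightarrow> g x = g y"
    and "\<And>x y. x \<in> S \<Longrightarrow> y \<in> S \<Longrightarrow> g x = g y \<Longrightarrow> d x y \<le> e"
  shows "chain_fine d r e S"
  unfolding chain_fine_def
proof (intro ballI allI impI)
  fix x y assume x: "x \<in> S" and "(x, y) \<in> (links d r S)\<^sup>*"
  from this(2) have "y \<in> S \<and> g x = g y"
  proof (induction rule: rtrancl_induct)
    case (step y z)
    then show ?case using assms(1)[of y z] by (auto simp: links_def)
  qed (simp add: x)
  with x assms(2) show "d x y \<le> e" by blast
qed

context Metric_space
begin

text \<open>A chain in the union leaves \<open>S\<close> only for excursions through \<open>T\<close>, which have diameter at most \<open>e\<close>.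
By the condition on \<open>R\<close>, the end points in \<open>S\<close> of such an excursion are less than \<open>R\<close> apart, so the
visits to \<open>S\<close> form a chain with steps shorter than \<open>R\<close>, and they stay within \<open>E\<close> of each other. The
additional terms account for the parts in \<open>T\<close> before the first and after the last visit.\<close>

lemma chain_fine_Un:
  assumes S: "S \<subseteq> M" and T: "T \<subseteq> M"
    and fS: "chain_fine d R E S" and fT: "chain_fine d r e T"
    and r: "0 < r" "0 \<le> e" "0 \<le> E" and R: "2 * r + e \<le> R"
  shows "chain_fine d r (E + 2 * e + 2 * r) (S \<union> T)"
proof -
  let ?U = "links d r (S \<union> T)" and ?S = "links d R S" and ?T = "links d r T"
  have tri: "d a c \<le> d a b + d b c" if "a \<in> S \<union> T" "b \<in> S \<union> T" "c \<in> S \<union> T" for a b c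
    using that S T by (intro triangle) auto
  have from_S: "d x y \<le> E + r + e" if x: "x \<in> S" and xy: "(x, y) \<in> ?U\<^sup>*" for x y
  proof -
    have "\<exists>s\<in>S. (x, s) \<in> ?S\<^sup>* \<and> (y = s \<or> y \<in> T \<and> (\<exists>t\<in>T. d s t < r \<and> (t, y) \<in> ?T\<^sup>*))"
      using xy
    proof (induction rule: rtrancl_induct)
      case base
      then show ?case using x by auto
    next
      case (step y z)
      then obtain s where s: "s \<in> S" "(x, s) \<in> ?S\<^sup>*"
        and or: "y = s \<or> y \<in> T \<and> (\<exists>t\<in>T. d s t < r \<and> (t, y) \<in> ?T\<^sup>*)" by blast
      have yz: "y \<in> S \<union> T" "z \<in> S \<union> T" "d y z < r" using step.hyps by (auto simp: links_def)
      from or show ?case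
      proof
        assume "y = s"
        show ?thesis
        proof (cases "z \<in> S")
          case True
          then have "(s, z) \<in> ?S" using s yz R r \<open>y = s\<close> by (auto simp: links_def)
          then show ?thesis using True s by (blast intro: rtrancl_into_rtrancl)
        next
          case False
          then show ?thesis using yz s \<open>y = s\<close> by blast
        qed
      next
        assume "y \<in> T \<and> (\<exists>t\<in>T. d s t < r \<and> (t, y) \<in> ?T\<^sup>*)"
        then obtain t where t: "y \<in> T" "t \<in> T" "d s t < r" "(t, y) \<in> ?T\<^sup>*" by blast
        show ?thesis
        proof (cases "z \<in> T")
          case True
          then have "(y, z) \<in> ?T" using t yz by (auto simp: links_def)
          then show ?thesis using True s t by (blast intro: rtrancl_into_rtrancl)
        next
          case False
          then have z: "z \<in> S" using yz by auto
          have "d t y \<le> e" using chain_fineD[OF fT] t by blast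
          then have "d s z < R"
            using tri[of s t z] tri[of t y z] t s z yz R by auto
          then have "(s, z) \<in> ?S" using s z by (auto simp: links_def)
          then show ?thesis using z s by (blast intro: rtrancl_into_rtrancl)
        qed
      qed
    qed
    then obtain s where s: "s \<in> S" "(x, s) \<in> ?S\<^sup>*"
      and or: "y = s \<or> y \<in> T \<and> (\<exists>t\<in>T. d s t < r \<and> (t, y) \<in> ?T\<^sup>*)" by blast
    have E: "d x s \<le> E" using chain_fineD[OF fS] x s by blast
    from or show ?thesis
    proof
      assume "y = s" then show ?thesis using E r by auto
    next
      assume "y \<in> T \<and> (\<exists>t\<in>T. d s t < r \<and> (t, y) \<in> ?T\<^sup>*)"
      then obtain t where t: "y \<in> T" "t \<in> T" "d s t < r" "(t, y) \<in> ?T\<^sup>*" by blast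
      have "d t y \<le> e" using chain_fineD[OF fT] t by blast
      then show ?thesis using E tri[of x s y] tri[of s t y] t s x by auto
    qed
  qed
  have from_T: "d x y \<le> E + 2 * e + 2 * r" if x: "x \<in> T" and xy: "(x, y) \<in> ?U\<^sup>*" for x y
  proof -
    have "y \<in> T \<and> (x, y) \<in> ?T\<^sup>* \<or> (\<exists>s\<in>S. d x s \<le> e + r \<and> (s, y) \<in> ?U\<^sup>*)"
      using xy
    proof (induction rule: rtrancl_induct)
      case base
      then show ?case using x by auto
    next
      case (step y z)
      have yz: "y \<in> S \<union> T" "z \<in> S \<union> T" "d y z < r" using step.hyps by (auto simp: links_def)
      from step.IH show ?case
      proof
        assume y: "y \<in> T \<and> (x, y) \<in> ?T\<^sup>*"
        show ?thesis
        proof (cases "z \<in> T")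
          case True
          then have "(y, z) \<in> ?T" using y yz by (auto simp: links_def)
          then show ?thesis using True y by (blast intro: rtrancl_into_rtrancl)
        next
          case False
          then have z: "z \<in> S" using yz by auto
          have "d x y \<le> e" using chain_fineD[OF fT] x y by blast
          then have "d x z \<le> e + r" using tri[of x y z] x y z yz by auto
          then show ?thesis using z by blast
        qed
      next
        assume "\<exists>s\<in>S. d x s \<le> e + r \<and> (s, y) \<in> ?U\<^sup>*"
        then show ?thesis using step.hyps by (blast intro: rtrancl_into_rtrancl)
      qed
    qed
    then show ?thesis
    proof
      assume "y \<in> T \<and> (x, y) \<in> ?T\<^sup>*"
      then have "d x y \<le> e" using chain_fineD[OF fT] x by blast
      then show ?thesis using r by auto
    next
      assume "\<exists>s\<in>S. d x s \<le> e + r \<and> (s, y) \<in> ?U\<^sup>*"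
      then obtain s where s: "s \<in> S" "d x s \<le> e + r" "(s, y) \<in> ?U\<^sup>*" by blast
      have "y \<in> S \<union> T" using chain_target[OF xy] x by auto
      then show ?thesis using from_S[OF s(1,3)] s tri[of x s y] x by auto
    qed
  qed
  show ?thesis
    unfolding chain_fine_def using from_S from_T r by fastforce
qed

text \<open>A chain of the neighbourhood is shadowed by a chain of \<open>S\<close> whose steps are longer by at most
\<open>2 * r\<close>.\<close>

lemma chain_fine_thicken:
  assumes S: "S \<subseteq> M" and r: "0 < r" and f: "chain_fine d (3 * r) e S"
  shows "chain_fine d r (e + 2 * r) (\<Union>x\<in>S. mball x r)"
  unfolding chain_fine_def
proof (intro ballI allI impI)
  let ?N = "\<Union>x\<in>S. mball x r"
  fix x y assume x: "x \<in> ?N" and "(x, y) \<in> (links d r ?N)\<^sup>*"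
  from x obtain s where s: "s \<in> S" "x \<in> M" "d s x < r" by auto
  from \<open>(x, y) \<in> _\<close> have "\<exists>t\<in>S. y \<in> M \<and> d t y < r \<and> (s, t) \<in> (links d (3 * r) S)\<^sup>*"
  proof (induction rule: rtrancl_induct)
    case base
    then show ?case using s by auto
  next
    case (step y z)
    then obtain t where t: "t \<in> S" "y \<in> M" "d t y < r" "(s, t) \<in> (links d (3 * r) S)\<^sup>*" by blast
    from step.hyps obtain u where u: "u \<in> S" "z \<in> M" "d u z < r" and yz: "d y z < r"
      by (auto simp: links_def)
    have "d t u < 3 * r"
      using triangle[of t y u] triangle[of y z u] commute[of u z] t u S yz by fastforce
    then have "(t, u) \<in> links d (3 * r) S" using t u by (auto simp: links_def)
    then show ?case using t u by (blast intro: rtrancl_into_rtrancl)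
  qed
  then obtain t where t: "t \<in> S" "y \<in> M" "d t y < r" "(s, t) \<in> (links d (3 * r) S)\<^sup>*" by blast
  have "d s t \<le> e" using chain_fineD[OF f] s t by blast
  then show "d x y \<le> e + 2 * r"
    using triangle[of x s y] triangle[of s t y] commute[of s x] s t S by fastforce
qed

text \<open>The scale for \<open>B\<close> is chosen after the gaps for \<open>A\<close> are known; then corresponding sets can be united.\<close>

lemma fine_dim_le_Un:
  assumes A: "A \<subseteq> M" "fine_dim_le d k A" and B: "B \<subseteq> M" "fine_dim_le d k B"
  shows "fine_dim_le d k (A \<union> B)"
  unfolding fine_dim_le_def
proof (intro allI impI)
  fix e :: real assume e: "0 < e"
  obtain R P where R: "R > 0" and P: "A \<subseteq> (\<Union>i\<le>k. P i)"
    "\<And>i. i \<le> k \<Longrightarrow> P i \<subseteq> A \<and> chain_fine d R (e/2) (P i)"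
    using A(2) e unfolding fine_dim_le_def by (metis half_gt_zero)
  \<comment> \<open>small enough for both the gap condition and the total bound of the union lemma\<close>
  define e' where "e' = min R e / 8"
  have e': "e' > 0" using R e by (simp add: e'_def)
  obtain r Q where r: "r > 0" and Q: "B \<subseteq> (\<Union>i\<le>k. Q i)"
    "\<And>i. i \<le> k \<Longrightarrow> Q i \<subseteq> B \<and> chain_fine d r e' (Q i)"
    using B(2) e' unfolding fine_dim_le_def by metis
  define r' where "r' = min r e'"
  have r': "r' > 0" using r e' by (simp add: r'_def)
  have "chain_fine d r' e (P i \<union> Q i)" if i: "i \<le> k" for i
  proof -
    have "chain_fine d r' e' (Q i)"
      using Q(2)[OF i] by (auto intro: chain_fine_mono simp: r'_def)
    moreover have "2 * r' + e' \<le> R" using e' R by (auto simp: r'_def e'_def)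
    ultimately have "chain_fine d r' (e/2 + 2 * e' + 2 * r') (P i \<union> Q i)"
      using P(2)[OF i] Q(2)[OF i] A B r' e' e by (intro chain_fine_Un[where R=R]) auto
    then show ?thesis
      by (rule chain_fine_mono) (use e e' R in \<open>auto simp: r'_def e'_def\<close>)
  qed
  moreover have "P i \<union> Q i \<subseteq> A \<union> B" if "i \<le> k" for i using P(2)[OF that] Q(2)[OF that] by blast
  moreover have "A \<union> B \<subseteq> (\<Union>i\<le>k. P i \<union> Q i)" using P(1) Q(1) by (auto simp: UN_Un_distrib)
  ultimately have "A \<union> B \<subseteq> (\<Union>i\<le>k. P i \<union> Q i) \<and>
      (\<forall>i\<le>k. P i \<union> Q i \<subseteq> A \<union> B \<and> chain_fine d r' e (P i \<union> Q i))" by simp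
  then show "\<exists>r>0. \<exists>C. A \<union> B \<subseteq> (\<Union>i\<le>k. C i) \<and>
      (\<forall>i\<le>k. C i \<subseteq> A \<union> B \<and> chain_fine d r e (C i))"
    by (intro exI[of _ r'] conjI[OF r'] exI[of _ "\<lambda>i. P i \<union> Q i"])
qed

lemma fine_dim_le_Union:
  assumes "finite I" "\<And>i. i \<in> I \<Longrightarrow> A i \<subseteq> M \<and> fine_dim_le d k (A i)"
  shows "fine_dim_le d k (\<Union>i\<in>I. A i)"
  using assms
proof (induction I)
  case empty
  have "\<exists>r>0. \<exists>B. {} \<subseteq> (\<Union>i\<le>k. B i) \<and> (\<forall>i\<le>k. B i \<subseteq> {} \<and> chain_fine d r e (B i))" for e :: real
    by (intro exI[of _ 1] conjI exI[of _ "\<lambda>i. {}"]) auto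
  then show ?case by (simp add: fine_dim_le_def)
next
  case (insert i I)
  then show ?case using fine_dim_le_Un[of "A i" k "\<Union>i\<in>I. A i"] by auto
qed

end

section \<open>Covering dimension of compact metric spaces\<close>

context Metric_space
begin

lemma lebesgue_open_cover:
  assumes cpt: "compact_space mtopology" and \<U>: "open_cover mtopology \<U>"
  obtains \<rho> where "\<rho> > 0" "\<And>x. x \<in> M \<Longrightarrow> \<exists>U\<in>\<U>. mball x \<rho> \<subseteq> U"
proof -
  have "M \<subseteq> \<Union>\<U>" "\<And>U. U \<in> \<U> \<Longrightarrow> openin mtopology U"
    using \<U> by (simp_all add: open_cover_def)
  moreover have "compactin mtopology M" using cpt by (simp add: compact_space_def)
  ultimately show thesis using lebesgue_number that by meson
qed

text \<open>The colours are the classes of points that are joined by a chain. Points at distance less than \<open>r\<close>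
share their class, so total boundedness leaves finitely many classes.\<close>

lemma finite_chain_coloring:
  assumes cpt: "compact_space mtopology" and S: "S \<subseteq> M" and r: "0 < r"
    and fine: "chain_fine d r e S"
  obtains c :: "'a \<Rightarrow> nat" and J where "\<And>x. x \<in> S \<Longrightarrow> c x < J"
    "\<And>x y. \<lbrakk>x \<in> S; y \<in> S; d x y < r\<rbrakk> \<Longrightarrow> c x = c y"
    "\<And>x y. \<lbrakk>x \<in> S; y \<in> S; c x = c y\<rbrakk> \<Longrightarrow> d x y \<le> e"
proof -
  define comp where "comp x = (links d r S)\<^sup>* `` {x}" for x
  have comp_eq: "comp x = comp y" if "x \<in> S" "y \<in> S" "d x y < r" for x y
  proof -
    have "(x, y) \<in> links d r S" "(y, x) \<in> links d r S"
      using that by (auto simp: links_def commute)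
    then show ?thesis unfolding comp_def
      by (blast intro: converse_rtrancl_into_rtrancl)
  qed
  have "compactin mtopology M" using cpt by (simp add: compact_space_def)
  then obtain K where K: "finite K" "M \<subseteq> (\<Union>z\<in>K. mball z (r/2))"
    using compactin_imp_mtotally_bounded r unfolding mtotally_bounded_def by (metis half_gt_zero)
  have "comp ` S \<subseteq> (\<lambda>z. comp (SOME x. x \<in> S \<inter> mball z (r/2))) ` K"
  proof (rule image_subsetI)
    fix x assume x: "x \<in> S"
    then obtain z where z: "z \<in> K" "x \<in> mball z (r/2)" using K(2) S by blast
    define x' where "x' = (SOME x. x \<in> S \<inter> mball z (r/2))"
    have x': "x' \<in> S \<inter> mball z (r/2)"
      unfolding x'_def by (rule someI[of _ x]) (use x z in auto)
    have "d x x' < r"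
      using triangle[of x z x'] x' z x S commute[of z x] by fastforce
    then have "comp x = comp x'" using comp_eq x x' by blast
    then show "comp x \<in> (\<lambda>z. comp (SOME x. x \<in> S \<inter> mball z (r/2))) ` K"
      using z x'_def by blast
  qed
  then have "finite (comp ` S)" using K(1) finite_surj by blast
  then obtain f :: "'a set \<Rightarrow> nat" and n where f: "f ` (comp ` S) = {i. i < n}" "inj_on f (comp ` S)"
    using finite_imp_inj_to_nat_seg by metis
  show ?thesis
  proof (rule that[of "\<lambda>x. f (comp x)" n])
    fix x y assume xy: "x \<in> S" "y \<in> S" "f (comp x) = f (comp y)"
    then have "comp x = comp y" using f(2) by (meson image_eqI inj_onD)
    then have "(x, y) \<in> (links d r S)\<^sup>*" unfolding comp_def by blast
    then show "d x y \<le> e" using chain_fineD[OF fine] xy by blast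
  qed (use f comp_eq in auto)
qed

lemma openin_color_class:
  assumes S: "openin mtopology S" and r: "0 < r"
    and c: "\<And>x y. \<lbrakk>x \<in> S; y \<in> S; d x y < r\<rbrakk> \<Longrightarrow> c x = c y"
  shows "openin mtopology {x \<in> S. P (c x)}"
  unfolding openin_mtopology
proof (intro conjI allI impI)
  show "{x \<in> S. P (c x)} \<subseteq> M" using openin_subset[OF S] by auto
  fix x assume x: "x \<in> {x \<in> S. P (c x)}"
  then obtain s where s: "s > 0" "mball x s \<subseteq> S" using S unfolding openin_mtopology by blast
  have "mball x (min r s) \<subseteq> {x \<in> S. P (c x)}"
  proof
    fix y assume "y \<in> mball x (min r s)"
    then have y: "y \<in> mball x s" "d x y < r" by auto
    then show "y \<in> {x \<in> S. P (c x)}" using c[of x y] x s(2) by auto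
  qed
  then show "\<exists>r>0. mball x r \<subseteq> {x \<in> S. P (c x)}" using r s(1) by (intro exI[of _ "min r s"]) auto
qed

text \<open>Thicken each of the \<open>k + 1\<close> sets to an open one and split it into its chain classes. A point lies in
at most one class of each set, hence in at most \<open>k + 1\<close> of these open sets.\<close>

lemma covering_dim_le_if_fine_dim_le:
  assumes cpt: "compact_space mtopology" and fd: "fine_dim_le d k M"
  shows "covering_dim_le mtopology (int k)"
  unfolding covering_dim_le_def
proof (intro allI impI)
  fix \<U> assume \<U>: "finite \<U> \<and> open_cover mtopology \<U>"
  obtain \<rho> where \<rho>: "\<rho> > 0" "\<And>x. x \<in> M \<Longrightarrow> \<exists>U\<in>\<U>. mball x \<rho> \<subseteq> U"
    using lebesgue_open_cover[OF cpt] \<U> by blast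
  have "\<rho> / 4 > 0" using \<rho> by simp
  then obtain R B where R: "R > 0" and B: "M \<subseteq> (\<Union>i\<le>k. B i)"
    "\<And>i. i \<le> k \<Longrightarrow> B i \<subseteq> M \<and> chain_fine d R (\<rho>/4) (B i)"
    using fd unfolding fine_dim_le_def by metis
  \<comment> \<open>thickening by \<open>r\<close> costs two thirds of the gap and keeps diameters below the Lebesgue number\<close>
  define r where "r = min (R/3) (\<rho>/4)"
  have r: "r > 0" using R \<rho> by (simp add: r_def)
  define N where "N i = (\<Union>x\<in>B i. mball x r)" for i
  have openN: "openin mtopology (N i)" for i unfolding N_def by blast
  have NM: "N i \<subseteq> M" for i unfolding N_def by auto
  have fineN: "chain_fine d r (\<rho>/4 + 2 * r) (N i)" if "i \<le> k" for i
    unfolding N_def using B(2)[OF that] r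
    by (intro chain_fine_thicken) (auto intro: chain_fine_mono simp: r_def)
  define col where "col i c J \<longleftrightarrow> (\<forall>x\<in>N i. c x < J) \<and> (\<forall>x\<in>N i. \<forall>y\<in>N i. d x y < r \<longrightarrow> c x = c y) \<and>
      (\<forall>x\<in>N i. \<forall>y\<in>N i. c x = c y \<longrightarrow> d x y \<le> \<rho>/4 + 2 * r)" for i and c :: "'a \<Rightarrow> nat" and J
  have "\<exists>c J. col i c J" if "i \<le> k" for i
    unfolding col_def by (rule finite_chain_coloring[OF cpt NM r fineN[OF that]]) blast
  then obtain c J where "\<And>i. i \<le> k \<Longrightarrow> col i (c i) (J i)" by metis
  then have
    c: "\<And>i x. i \<le> k \<Longrightarrow> x \<in> N i \<Longrightarrow> c i x < J i"
      "\<And>i x y. i \<le> k \<Longrightarrow> x \<in> N i \<Longrightarrow> y \<in> N i \<Longrightarrow> d x y < r \<Longrightarrow> c i x = c i y"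
      "\<And>i x y. i \<le> k \<Longrightarrow> x \<in> N i \<Longrightarrow> y \<in> N i \<Longrightarrow> c i x = c i y \<Longrightarrow> d x y \<le> \<rho>/4 + 2 * r"
    unfolding col_def by blast+
  define W where "W = (\<lambda>(i, j). {x \<in> N i. c i x = j})"
  define \<V> where "\<V> = W ` (SIGMA i:{..k}. {..<J i}) - {{}}"
  have fin: "finite \<V>" unfolding \<V>_def by auto
  have "openin mtopology V" if "V \<in> \<V>" for V
    using that c(2) openin_color_class[OF openN r, of _ "c _"] unfolding \<V>_def W_def by force
  moreover have "M \<subseteq> \<Union>\<V>"
  proof
    fix x assume x: "x \<in> M"
    then obtain i where i: "i \<le> k" "x \<in> B i" using B by auto
    then have xi: "x \<in> N i" unfolding N_def using x r by force
    then have "x \<in> W (i, c i x)" "(i, c i x) \<in> (SIGMA i:{..k}. {..<J i})"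
      using c(1) i unfolding W_def by auto
    then show "x \<in> \<Union>\<V>" unfolding \<V>_def by blast
  qed
  moreover have "\<Union>\<V> \<subseteq> M" using NM unfolding \<V>_def W_def by auto
  ultimately have cover: "open_cover mtopology \<V>" unfolding open_cover_def topspace_mtopology by blast
  have refines: "cover_refines \<V> \<U>"
    unfolding cover_refines_def
  proof
    fix V assume V: "V \<in> \<V>"
    then obtain i j where ij: "i \<le> k" "V = W (i, j)" "V \<noteq> {}" unfolding \<V>_def by blast
    then obtain x where x: "x \<in> N i" "c i x = j" unfolding W_def by auto
    obtain U where U: "U \<in> \<U>" "mball x \<rho> \<subseteq> U" using \<rho>(2) x NM by blast
    have "\<rho>/4 + 2 * r < \<rho>" using \<rho>(1) by (simp add: r_def)
    then have "V \<subseteq> mball x \<rho>" using ij x c(3)[OF ij(1) x(1)] NM unfolding W_def by fastforce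
    then show "\<exists>U\<in>\<U>. V \<subseteq> U" using U by blast
  qed
  have "card {V \<in> \<V>. x \<in> V} \<le> k + 1" for x
  proof -
    have "{V \<in> \<V>. x \<in> V} \<subseteq> (\<lambda>i. W (i, c i x)) ` {..k}"
      unfolding \<V>_def W_def by auto
    then show ?thesis using surj_card_le[of "{..k}"] by fastforce
  qed
  then have "\<forall>x\<in>topspace mtopology. int (card {V \<in> \<V>. x \<in> V}) \<le> int k + 1"
    by (metis of_nat_1 of_nat_add of_nat_le_iff)
  with fin cover refines show "\<exists>\<V>. finite \<V> \<and> open_cover mtopology \<V> \<and> cover_refines \<V> \<U> \<and>
      (\<forall>x\<in>topspace mtopology. int (card {V \<in> \<V>. x \<in> V}) \<le> int k + 1)" by blast
qed

text \<open>The distance to the complement of \<open>U\<close>, truncated at 1 so that it also makes sense if the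
complement is empty.\<close>

definition compl_dist :: "'a set \<Rightarrow> 'a \<Rightarrow> real" where
  "compl_dist U x = Inf (insert 1 (d x ` (M - U)))"

lemma compl_dist_bdd: "bdd_below (insert 1 (d x ` (M - U)))"
  by (rule bdd_belowI[of _ 0]) auto

lemma compl_dist_nonneg: "0 \<le> compl_dist U x"
  unfolding compl_dist_def by (rule cInf_greatest) auto

lemma compl_dist_outside: "x \<in> M \<Longrightarrow> x \<notin> U \<Longrightarrow> compl_dist U x = 0"
proof -
  assume "x \<in> M" "x \<notin> U"
  then have "d x x \<in> insert 1 (d x ` (M - U))" by blast
  then have "compl_dist U x \<le> d x x"
    unfolding compl_dist_def by (rule cInf_lower[OF _ compl_dist_bdd])
  then show ?thesis using compl_dist_nonneg[of U x] \<open>x \<in> M\<close> by simp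
qed

lemma compl_dist_ball:
  assumes "mball x \<rho> \<subseteq> U" "\<rho> \<le> 1" "x \<in> M" shows "\<rho> \<le> compl_dist U x"
  unfolding compl_dist_def
proof (rule cInf_greatest)
  fix t assume "t \<in> insert 1 (d x ` (M - U))"
  then show "\<rho> \<le> t" using assms by (auto simp: subset_iff not_less[symmetric])
qed auto

lemma compl_dist_Lipschitz:
  assumes "x \<in> M" "y \<in> M" shows "\<bar>compl_dist U x - compl_dist U y\<bar> \<le> d x y"
proof -
  have "compl_dist U x - d x y \<le> compl_dist U y" if "x \<in> M" "y \<in> M" for x y
    unfolding compl_dist_def[of U y]
  proof (rule cInf_greatest)
    fix t assume t: "t \<in> insert 1 (d y ` (M - U))"
    have low: "compl_dist U x \<le> s" if "s \<in> insert 1 (d x ` (M - U))" for s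
      unfolding compl_dist_def using that by (rule cInf_lower[OF _ compl_dist_bdd])
    from t show "compl_dist U x - d x y \<le> t"
    proof
      assume "t = 1"
      then show ?thesis using low[OF insertI1] nonneg[of x y] by linarith
    next
      assume "t \<in> d y ` (M - U)"
      then obtain z where z: "z \<in> M - U" "t = d y z" by blast
      then show ?thesis using low[of "d x z"] triangle[of x y z] that by auto
    qed
  qed auto
  from this[of x y] this[of y x] show ?thesis using assms commute[of x y] by linarith
qed

lemma continuous_compl_dist: "continuous_map mtopology euclideanreal (compl_dist U)"
proof -
  have "\<exists>\<delta>>0. \<forall>y\<in>M. d y x < \<delta> \<longrightarrow> \<bar>compl_dist U y - compl_dist U x\<bar> < e" if "x \<in> M" "e > 0" for x e
    using compl_dist_Lipschitz that by (intro exI[of _ e]) (meson order_le_less_trans)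
  then show ?thesis
    unfolding mtopology_is_euclidean[symmetric]
    by (subst metric_continuous_map[OF Met_TC.Metric_space_axioms])
      (simp add: dist_real_def commute abs_minus_commute, blast)
qed

lemma compl_dist_pos:
  assumes "openin mtopology U" "x \<in> U" shows "0 < compl_dist U x"
proof -
  obtain \<rho> where \<rho>: "\<rho> > 0" "mball x \<rho> \<subseteq> U" using assms unfolding openin_mtopology by blast
  have "x \<in> M" using openin_subset[OF assms(1)] assms(2) by auto
  moreover have "mball x (min \<rho> 1) \<subseteq> U" using \<rho>(2) by auto
  ultimately have "min \<rho> 1 \<le> compl_dist U x" using compl_dist_ball[of x "min \<rho> 1" U] by simp
  then show ?thesis using \<rho>(1) by linarith
qed

text \<open>At each point, at most \<open>k + 1\<close> of the distances to the complements of the members of a cover of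
order \<open>k + 1\<close> are positive, and the largest one is at least a constant \<open>c\<close>. Divide the interval from
0 to \<open>c\<close> into \<open>k + 1\<close> equal parts. The other positive distances, at most
\<open>k\<close> in number, miss one of these parts; let \<open>G j\<close>
consist of the points at which the \<open>j\<close>-th part is missed. The set of those members whose distance
lies above the missed part cannot change along short steps in \<open>G j\<close>, and it is not empty: so
chains in \<open>G j\<close> stay in a single member of the cover.\<close>

lemma fine_dim_le_if_covering_dim_le:
  assumes cpt: "compact_space mtopology" and dim: "covering_dim_le mtopology (int k)"
  shows "fine_dim_le d k M"
  unfolding fine_dim_le_def
proof (intro allI impI)
  fix e :: real assume e: "e > 0"
  have cM: "compactin mtopology M" using cpt by (simp add: compact_space_def)
  have "M \<subseteq> \<Union>((\<lambda>x. mball x (e/2)) ` M)" using e by auto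
  then obtain \<F> where \<F>: "finite \<F>" "\<F> \<subseteq> (\<lambda>x. mball x (e/2)) ` M" "M \<subseteq> \<Union>\<F>"
    using compactinD[OF cM, of "(\<lambda>x. mball x (e/2)) ` M"] by auto
  have "\<Union>\<F> = M" using \<F>(2,3) mball_subset_mspace by blast
  moreover have "\<forall>U\<in>\<F>. openin mtopology U" using \<F>(2) openin_mball by blast
  ultimately have "finite \<F> \<and> open_cover mtopology \<F>"
    using \<F>(1) unfolding open_cover_def topspace_mtopology by blast
  then obtain \<V> where \<V>: "finite \<V>" "open_cover mtopology \<V>" "cover_refines \<V> \<F>"
    and ord: "\<And>x. x \<in> M \<Longrightarrow> int (card {V \<in> \<V>. x \<in> V}) \<le> int k + 1"
    using dim[unfolded covering_dim_le_def topspace_mtopology, rule_format, of \<F>] by metis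
  have small: "d x y \<le> e" if V: "V \<in> \<V>" "x \<in> V" "y \<in> V" for V x y
  proof -
    obtain F where F: "F \<in> \<F>" "V \<subseteq> F" using \<V>(3) V(1) unfolding cover_refines_def by metis
    obtain z where "z \<in> M" "F = mball z (e/2)" using subsetD[OF \<F>(2) F(1)] by blast
    then have "z \<in> M" "V \<subseteq> mball z (e/2)" using F(2) by simp_all
    then have "x \<in> mball z (e/2)" "y \<in> mball z (e/2)" using V by blast+
    then show ?thesis using triangle[of x z y] commute[of z x] by simp
  qed
  obtain \<rho> where \<rho>: "\<rho> > 0" "\<And>x. x \<in> M \<Longrightarrow> \<exists>U\<in>\<V>. mball x \<rho> \<subseteq> U"
    using lebesgue_open_cover[OF cpt \<V>(2)] by blast
  define c where "c = min \<rho> 1"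
  have c: "c > 0" using \<rho> by (simp add: c_def)
  have big: "\<exists>V\<in>\<V>. c \<le> compl_dist V x" if x: "x \<in> M" for x
  proof -
    obtain V where V: "V \<in> \<V>" "mball x \<rho> \<subseteq> V" using \<rho>(2)[OF x] by blast
    then have "mball x c \<subseteq> V" unfolding c_def by auto
    then show ?thesis using compl_dist_ball[of x c V] V x c_def by auto
  qed
  define \<eta> where "\<eta> = c / (real k + 1)"
  have \<eta>: "\<eta> > 0" "(real k + 1) * \<eta> = c" using c by (auto simp: \<eta>_def field_simps)
  define G where "G j = {x \<in> M. \<forall>V\<in>\<V>. \<not> (real j * \<eta> < compl_dist V x \<and> compl_dist V x < (real j + 1) * \<eta>)}" for j
  have "M \<subseteq> (\<Union>j\<le>k. G j)"
  proof
    fix x assume x: "x \<in> M"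
    show "x \<in> (\<Union>j\<le>k. G j)"
    proof (rule ccontr)
      assume "x \<notin> (\<Union>j\<le>k. G j)"
      then have "\<forall>j\<in>{..k}. \<exists>V\<in>\<V>. real j * \<eta> < compl_dist V x \<and> compl_dist V x < (real j + 1) * \<eta>"
        using x unfolding G_def by auto
      then obtain V where V: "\<And>j. j \<le> k \<Longrightarrow> V j \<in> \<V>"
        "\<And>j. j \<le> k \<Longrightarrow> real j * \<eta> < compl_dist (V j) x \<and> compl_dist (V j) x < (real j + 1) * \<eta>"
        by (metis atMost_iff)
      obtain V0 where V0: "V0 \<in> \<V>" "c \<le> compl_dist V0 x" using big[OF x] by blast
      have ne: "V i \<noteq> V j" if "i < j" "j \<le> k" for i j
      proof
        assume eq: "V i = V j"
        have "(real i + 1) * \<eta> \<le> real j * \<eta>" using that(1) \<eta>(1) by (intro mult_right_mono) auto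
        then show False using V(2)[of i] V(2)[of j] that eq by auto
      qed
      then have "inj_on V {..k}"
        by (intro linorder_inj_onI) (auto simp: le_less)
      moreover have "V j \<in> {W \<in> \<V>. x \<in> W} - {V0}" if j: "j \<le> k" for j
      proof -
        have "0 \<le> real j * \<eta>" using \<eta> by simp
        then have "compl_dist (V j) x \<noteq> 0" using V(2)[OF j] by linarith
        then have "x \<in> V j" using compl_dist_outside x by blast
        moreover have "(real j + 1) * \<eta> \<le> (real k + 1) * \<eta>"
          using j \<eta>(1) by (intro mult_right_mono) auto
        then have "V j \<noteq> V0" using V(2)[OF j] V0(2) \<eta>(2) by (metis less_le_not_le order_trans)
        ultimately show ?thesis using V(1)[OF j] by auto
      qed
      ultimately have "card {..k} \<le> card ({W \<in> \<V>. x \<in> W} - {V0})"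
        using \<V>(1) by (intro card_inj_on_le[of V]) auto
      moreover have "V0 \<in> {W \<in> \<V>. x \<in> W}"
        using V0 c compl_dist_outside x by force
      ultimately show False using ord[OF x] \<V>(1) by (simp add: card_Diff_singleton)
    qed
  qed
  moreover have "chain_fine d \<eta> e (G j)" if j: "j \<le> k" for j
  proof (rule chain_fine_label)
    let ?g = "\<lambda>x. {V \<in> \<V>. (real j + 1) * \<eta> \<le> compl_dist V x}"
    have step: "?g x \<subseteq> ?g y" if "x \<in> G j" "y \<in> G j" "d x y < \<eta>" for x y
    proof
      fix V assume V: "V \<in> ?g x"
      have "x \<in> M" "y \<in> M" using that by (auto simp: G_def)
      then have "compl_dist V x - compl_dist V y < \<eta>"
        using compl_dist_Lipschitz[of x y V] that by auto
      then have "real j * \<eta> < compl_dist V y" using V by (auto simp: algebra_simps)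
      then show "V \<in> ?g y" using V \<open>y \<in> G j\<close> unfolding G_def by auto
    qed
    show "?g x = ?g y" if "x \<in> G j" "y \<in> G j" "d x y < \<eta>" for x y
      using that commute[of y x] by (intro equalityI step) simp_all
    show "d x y \<le> e" if xy: "x \<in> G j" "y \<in> G j" "?g x = ?g y" for x y
    proof -
      have xM: "x \<in> M" "y \<in> M" using xy by (auto simp: G_def)
      have "(real j + 1) * \<eta> \<le> c" unfolding \<eta>(2)[symmetric] using j \<eta>(1) by (intro mult_right_mono) auto
      then obtain V where V: "V \<in> ?g x" using big[OF xM(1)] by fastforce
      then have V': "V \<in> ?g y" using xy(3) by blast
      have "0 < (real j + 1) * \<eta>" using \<eta> by simp
      then have "x \<in> V" "y \<in> V" using V V' xM compl_dist_outside by force+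
      then show ?thesis using small V by blast
    qed
  qed
  moreover have "G j \<subseteq> M" for j unfolding G_def by auto
  ultimately have "M \<subseteq> (\<Union>j\<le>k. G j) \<and> (\<forall>j\<le>k. G j \<subseteq> M \<and> chain_fine d \<eta> e (G j))" by blast
  then show "\<exists>r>0. \<exists>B. M \<subseteq> (\<Union>i\<le>k. B i) \<and> (\<forall>i\<le>k. B i \<subseteq> M \<and> chain_fine d r e (B i))"
    by (intro exI[of _ \<eta>] conjI[OF \<eta>(1)] exI[of _ G])
qed

lemma partition_of_unity:
  assumes fin: "finite I" and op: "\<And>i. i \<in> I \<Longrightarrow> openin mtopology (V i)" and cov: "M \<subseteq> (\<Union>i\<in>I. V i)"
  obtains \<phi> :: "'i \<Rightarrow> 'a \<Rightarrow> real" where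
    "\<And>i. i \<in> I \<Longrightarrow> continuous_map mtopology euclideanreal (\<phi> i)"
    "\<And>i x. 0 \<le> \<phi> i x"
    "\<And>x. x \<in> M \<Longrightarrow> (\<Sum>i\<in>I. \<phi> i x) = 1"
    "\<And>i x. \<lbrakk>i \<in> I; x \<in> M; 0 < \<phi> i x\<rbrakk> \<Longrightarrow> x \<in> V i"
proof
  define D where "D x = (\<Sum>i\<in>I. compl_dist (V i) x)" for x
  have D: "D x > 0" if x: "x \<in> M" for x
  proof -
    obtain i where i: "i \<in> I" "x \<in> V i" using cov x by blast
    then have "0 < compl_dist (V i) x" using compl_dist_pos op by blast
    then show ?thesis unfolding D_def using i fin compl_dist_nonneg by (intro sum_pos2) auto
  qed
  let ?\<phi> = "\<lambda>i x. compl_dist (V i) x / D x"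
  show "continuous_map mtopology euclideanreal (?\<phi> i)" for i
    using D unfolding D_def
    by (intro continuous_map_real_divide continuous_map_sum continuous_compl_dist) (force simp: fin)+
  show "0 \<le> ?\<phi> i x" for i x
    unfolding D_def by (simp add: compl_dist_nonneg sum_nonneg)
  show "(\<Sum>i\<in>I. ?\<phi> i x) = 1" if "x \<in> M" for x
    using D[OF that] unfolding sum_divide_distrib[symmetric] D_def[symmetric] by simp
  show "x \<in> V i" if "i \<in> I" "x \<in> M" "0 < ?\<phi> i x" for i x
    using compl_dist_outside[of x "V i"] that by (metis div_0 less_irrefl)
qed

end

lemma covering_dim_leI: "covering_dim_le X (int k) \<Longrightarrow> covering_dim X \<le> ereal (real k)"
  unfolding covering_dim_def by (rule Inf_lower) (auto intro!: exI[of _ "int k"])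

lemma covering_dim_le_mono: "covering_dim_le X m \<Longrightarrow> m \<le> n \<Longrightarrow> covering_dim_le X n"
  unfolding covering_dim_le_def by (meson add_right_mono order_trans)

lemma covering_dim_le_of_nat:
  assumes "covering_dim X \<le> ereal (real k)" shows "covering_dim_le X (int k)"
proof -
  have "covering_dim X < ereal (real k + 1)" using assms by (simp add: le_less_trans)
  then obtain n where n: "ereal (of_int n) < ereal (real k + 1)" "covering_dim_le X n"
    unfolding covering_dim_def Inf_less_iff by blast
  then have "n \<le> int k" by simp
  then show ?thesis using covering_dim_le_mono n(2) by blast
qed

text \<open>For a nonempty space the infimum in the definition is over natural numbers, and so is attained.\<close>

lemma covering_dim_cases:
  assumes "topspace X \<noteq> {}"
  obtains "covering_dim X = \<infinity>" | n where "covering_dim X = ereal (real n)" "covering_dim_le X (int n)"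
proof (cases "\<exists>n. covering_dim_le X n")
  case False
  then have "covering_dim X = \<infinity>" unfolding covering_dim_def by (simp add: top_ereal_def)
  then show ?thesis using that(1) by blast
next
  case True
  have nonneg: "0 \<le> n" if le: "covering_dim_le X n" for n
  proof -
    obtain x where x: "x \<in> topspace X" using assms by blast
    have "finite {topspace X} \<and> open_cover X {topspace X}" by (simp add: open_cover_def)
    then obtain \<V> where \<V>: "finite \<V>" "open_cover X \<V>" "\<forall>x\<in>topspace X. int (card {V \<in> \<V>. x \<in> V}) \<le> n + 1"
      using le unfolding covering_dim_le_def by meson
    obtain V where "V \<in> \<V>" "x \<in> V" using \<V>(2) x unfolding open_cover_def by blast
    then have "card {V \<in> \<V>. x \<in> V} > 0" using \<V>(1) by (auto simp: card_gt_0_iff)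
    then show ?thesis using \<V>(3) x by force
  qed
  obtain m where m: "covering_dim_le X m" using True by blast
  then have "covering_dim_le X (int (nat m))" using nonneg[OF m] by simp
  define n where "n = (LEAST n. covering_dim_le X (int n))"
  have n: "covering_dim_le X (int n)"
    unfolding n_def by (rule LeastI) fact
  have least: "int n \<le> j" if j: "covering_dim_le X j" for j
  proof -
    have "covering_dim_le X (int (nat j))" using nonneg[OF j] j by simp
    then have "n \<le> nat j" unfolding n_def by (rule Least_le)
    then show ?thesis using nonneg[OF j] by simp
  qed
  have "covering_dim X = ereal (real n)"
  proof (rule antisym)
    show "covering_dim X \<le> ereal (real n)" using n by (rule covering_dim_leI)
    show "ereal (real n) \<le> covering_dim X"
      unfolding covering_dim_def
    proof (rule Inf_greatest)
      fix t assume "t \<in> {ereal (of_int j) | j. -1 \<le> j \<and> covering_dim_le X j}"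
      then obtain j where "t = ereal (of_int j)" "covering_dim_le X j" by blast
      then show "ereal (real n) \<le> t" using least[of j] by simp
    qed
  qed
  then show ?thesis using that(2) n by blast
qed

lemma open_cover_Int:
  assumes "open_cover X \<U>" "open_cover X \<V>"
  shows "open_cover X {U \<inter> V | U V. U \<in> \<U> \<and> V \<in> \<V>}"
  unfolding open_cover_def
proof (intro conjI ballI)
  show "openin X W" if "W \<in> {U \<inter> V | U V. U \<in> \<U> \<and> V \<in> \<V>}" for W
    using that assms unfolding open_cover_def by auto
  have "x \<in> \<Union>{U \<inter> V | U V. U \<in> \<U> \<and> V \<in> \<V>} \<longleftrightarrow> x \<in> \<Union>\<U> \<and> x \<in> \<Union>\<V>" for x by auto
  then show "\<Union>{U \<inter> V | U V. U \<in> \<U> \<and> V \<in> \<V>} = topspace X"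
    using assms unfolding open_cover_def by auto
qed

lemma finite_refinement_of_small_order:
  assumes "compact_space Y" "open_cover Y \<U>"
  obtains \<V> where "finite \<V>" "open_cover Y \<V>" "cover_refines \<V> \<U>"
    "\<And>n. covering_dim Y = ereal (real n) \<Longrightarrow> \<forall>y\<in>topspace Y. card {V \<in> \<V>. y \<in> V} \<le> n + 1"
proof -
  obtain \<F> where \<F>: "finite \<F>" "\<F> \<subseteq> \<U>" "open_cover Y \<F>"
    using assms unfolding compact_space open_cover_def by (metis subsetD)
  have ref: "cover_refines \<F> \<U>" using \<F>(2) unfolding cover_refines_def by blast
  show thesis
  proof (cases "\<exists>n. covering_dim Y = ereal (real n)")
    case False
    then show ?thesis using that[OF \<F>(1,3) ref] by blast
  next
    case True
    then obtain n where n: "covering_dim Y = ereal (real n)" by blast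
    then have "covering_dim_le Y (int n)" by (intro covering_dim_le_of_nat) simp
    then obtain \<V> where \<V>: "finite \<V>" "open_cover Y \<V>" "cover_refines \<V> \<F>"
      "\<forall>y\<in>topspace Y. int (card {V \<in> \<V>. y \<in> V}) \<le> int n + 1"
      using \<F> unfolding covering_dim_le_def by meson
    have "cover_refines \<V> \<U>" using \<V>(3) ref unfolding cover_refines_def by (meson order_trans)
    moreover have "card {V \<in> \<V>. y \<in> V} \<le> m + 1" if "covering_dim Y = ereal (real m)" "y \<in> topspace Y" for m y
    proof -
      have "m = n" using that(1) n by simp
      then show ?thesis using \<V>(4) that(2) by force
    qed
    ultimately show ?thesis using that \<V>(1,2) by blast
  qed
qed

section \<open>Decomposing the domain over a C-space\<close>

context Metric_space
begin

text \<open>This says that \<open>f\<close> looks \<open>k\<close>-dimensional over \<open>U\<close> at the scale \<open>e\<close>.\<close>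

definition fine_over :: "('a \<Rightarrow> 'b) \<Rightarrow> nat \<Rightarrow> real \<Rightarrow> real \<Rightarrow> 'b set \<Rightarrow> bool" where
  "fine_over f k r e U \<longleftrightarrow>
     (\<exists>G. (\<forall>i\<le>k. openin mtopology (G i) \<and> chain_fine d r e (G i)) \<and> {x \<in> M. f x \<in> U} \<subseteq> (\<Union>i\<le>k. G i))"

lemma fine_over_mono:
  assumes "fine_over f k r e U" "r' \<le> r" "V \<subseteq> U"
  shows "fine_over f k r' e V"
proof -
  obtain G where G: "\<forall>i\<le>k. openin mtopology (G i) \<and> chain_fine d r e (G i)" "{x \<in> M. f x \<in> U} \<subseteq> (\<Union>i\<le>k. G i)"
    using assms(1) unfolding fine_over_def by metis
  have "\<forall>i\<le>k. openin mtopology (G i) \<and> chain_fine d r' e (G i)"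
    using G(1) assms(2) by (auto intro: chain_fine_mono)
  moreover have "{x \<in> M. f x \<in> V} \<subseteq> (\<Union>i\<le>k. G i)" using G(2) assms(3) by blast
  ultimately show ?thesis unfolding fine_over_def by metis
qed

text \<open>The fibre over \<open>y\<close> is covered by \<open>k + 1\<close> fine sets, and so is a neighbourhood of it. Since \<open>f\<close> is a
closed map, this neighbourhood contains the preimage of a neighbourhood of \<open>y\<close>.\<close>

lemma fine_over_neighbourhood:
  assumes cpt: "compact_space mtopology" and f: "continuous_map mtopology Y f"
    and Y: "Hausdorff_space Y" and y: "y \<in> topspace Y"
    and dim: "covering_dim_le (subtopology mtopology {x \<in> M. f x = y}) (int k)" and e: "0 < e"
  obtains U r where "openin Y U" "y \<in> U" "0 < r" "fine_over f k r e U"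
proof -
  define F where "F = {x \<in> M. f x = y}"
  have FM: "F \<subseteq> M" by (auto simp: F_def)
  interpret F: Submetric M d F by unfold_locales (rule FM)
  have top: "F.sub.mtopology = subtopology mtopology F" by (rule F.mtopology_submetric)
  have "closedin Y {y}" using Y y by (simp add: Hausdorff_imp_t1_space t1_space_closedin_singleton[THEN iffD1])
  then have "closedin mtopology {x \<in> topspace mtopology. f x \<in> {y}}"
    using closedin_continuous_map_preimage f by blast
  then have "closedin mtopology F" by (simp add: F_def)
  then have "compactin mtopology F" using cpt closedin_compact_space by blast
  then have cF: "compact_space F.sub.mtopology" by (simp add: top compact_space_subtopology)
  have "covering_dim_le F.sub.mtopology (int k)" using dim unfolding F_def[symmetric] top .
  then have "fine_dim_le d k F" by (rule F.sub.fine_dim_le_if_covering_dim_le[OF cF])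
  moreover have "e/2 > 0" using e by simp
  ultimately obtain R B where R: "R > 0" and B: "F \<subseteq> (\<Union>i\<le>k. B i)"
    "\<And>i. i \<le> k \<Longrightarrow> B i \<subseteq> F \<and> chain_fine d R (e/2) (B i)"
    unfolding fine_dim_le_def by metis
  define r where "r = min (R/3) (e/4)"
  have r: "r > 0" using R e by (simp add: r_def)
  define G where "G i = (\<Union>x\<in>B i. mball x r)" for i
  have openG: "openin mtopology (G i)" for i unfolding G_def by blast
  have fineG: "chain_fine d r e (G i)" if i: "i \<le> k" for i
  proof -
    have "chain_fine d (3 * r) (e/2) (B i)" using B(2)[OF i] by (auto intro: chain_fine_mono simp: r_def)
    then have "chain_fine d r (e/2 + 2 * r) (G i)"
      unfolding G_def using B(2)[OF i] FM r by (intro chain_fine_thicken) auto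
    then show ?thesis by (rule chain_fine_mono) (auto simp: r_def)
  qed
  define C where "C = M - (\<Union>i\<le>k. G i)"
  have "openin mtopology (\<Union>i\<le>k. G i)" using openG by blast
  then have "closedin mtopology C" unfolding C_def by (simp add: closedin_diff)
  moreover have "closed_map mtopology Y f" using continuous_imp_closed_map f cpt Y by blast
  ultimately have "closedin Y (f ` C)" unfolding closed_map_def by blast
  then have openU: "openin Y (topspace Y - f ` C)" by blast
  have "F \<subseteq> (\<Union>i\<le>k. G i)"
  proof
    fix x assume x: "x \<in> F"
    then obtain i where "i \<le> k" "x \<in> B i" using B(1) by blast
    then show "x \<in> (\<Union>i\<le>k. G i)" using r FM x unfolding G_def by force
  qed
  then have yU: "y \<in> topspace Y - f ` C" using y by (auto simp: C_def F_def)
  have "{x \<in> M. f x \<in> topspace Y - f ` C} \<subseteq> (\<Union>i\<le>k. G i)" by (auto simp: C_def)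
  then have "fine_over f k r e (topspace Y - f ` C)"
    unfolding fine_over_def using openG fineG by (intro exI[of _ G]) simp
  then show thesis using that openU yU r by blast
qed

lemma fine_over_cover:
  assumes cpt: "compact_space mtopology" and f: "continuous_map mtopology Y f"
    and Y: "Hausdorff_space Y" "compact_space Y"
    and dim: "\<And>y. y \<in> topspace Y \<Longrightarrow> covering_dim_le (subtopology mtopology {x \<in> M. f x = y}) (int k)"
    and e: "0 < e"
  obtains \<alpha> r where "open_cover Y \<alpha>" "0 < r" "\<And>U. U \<in> \<alpha> \<Longrightarrow> fine_over f k r e U"
proof -
  have "\<exists>U r. openin Y U \<and> y \<in> U \<and> 0 < r \<and> fine_over f k r e U" if y: "y \<in> topspace Y" for y
    by (rule fine_over_neighbourhood[OF cpt f Y(1) y dim[OF y] e]) blast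
  then obtain U r where U: "\<And>y. y \<in> topspace Y \<Longrightarrow> openin Y (U y) \<and> y \<in> U y \<and> 0 < r y \<and> fine_over f k (r y) e (U y)"
    by metis
  have "topspace Y \<subseteq> \<Union>(U ` topspace Y)" using U by blast
  then obtain \<F> where \<F>: "finite \<F>" "\<F> \<subseteq> U ` topspace Y" "topspace Y \<subseteq> \<Union>\<F>"
    using Y(2) U unfolding compact_space_alt by (metis (no_types, lifting) imageE)
  then obtain I where I: "finite I" "I \<subseteq> topspace Y" "\<F> = U ` I"
    using finite_subset_image by metis
  define r0 where "r0 = Min (insert 1 (r ` I))"
  have r0: "r0 > 0" "\<And>y. y \<in> I \<Longrightarrow> r0 \<le> r y"
    using I U unfolding r0_def by (auto simp: subset_iff)
  have "\<And>V. V \<in> \<F> \<Longrightarrow> openin Y V" using U \<F>(2) by blast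
  then have "open_cover Y \<F>" using \<F>(3) openin_subset unfolding open_cover_def by blast
  moreover have "fine_over f k r0 e V" if "V \<in> \<F>" for V
    using fine_over_mono U r0(2) I that by blast
  ultimately show thesis using that r0(1) by blast
qed

text \<open>The sets \<open>V' V\<close> keep a distance from the complement of \<open>V\<close> that depends only on the Lebesgue number,
and \<open>\<O>\<close> consists of sets smaller than that distance.\<close>

lemma open_cover_shrink:
  assumes cpt: "compact_space mtopology" and cov: "open_cover mtopology \<F>"
  obtains V' \<O> where "\<And>V. V \<in> \<F> \<Longrightarrow> openin mtopology (V' V)" "M \<subseteq> (\<Union>V\<in>\<F>. V' V)"
    "open_cover mtopology \<O>" "\<And>P V. \<lbrakk>P \<in> \<O>; V \<in> \<F>; P \<inter> V' V \<noteq> {}\<rbrakk> \<Longrightarrow> P \<subseteq> V"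
proof -
  obtain q where q: "q > 0" "\<And>x. x \<in> M \<Longrightarrow> \<exists>U\<in>\<F>. mball x q \<subseteq> U"
    using lebesgue_open_cover[OF cpt cov] by blast
  define V' where "V' V = (\<Union>y\<in>{y\<in>M. mball y q \<subseteq> V}. mball y (q/2))" for V
  define \<O> where "\<O> = (\<lambda>y. mball y (q/4)) ` M"
  have op: "openin mtopology (V' V)" for V unfolding V'_def by blast
  have cov': "M \<subseteq> (\<Union>V\<in>\<F>. V' V)"
  proof
    fix x assume x: "x \<in> M"
    then obtain U where "U \<in> \<F>" "mball x q \<subseteq> U" using q(2) by blast
    moreover have "x \<in> mball x (q/2)" using x q(1) by simp
    ultimately show "x \<in> (\<Union>V\<in>\<F>. V' V)" using x unfolding V'_def by blast
  qed
  have cov\<O>: "open_cover mtopology \<O>"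
    using q(1) unfolding open_cover_def \<O>_def by auto
  have sub: "P \<subseteq> V" if P: "P \<in> \<O>" and ne: "P \<inter> V' V \<noteq> {}" for P V
  proof
    fix w assume w: "w \<in> P"
    obtain y where y: "y \<in> M" "P = mball y (q/4)" using P unfolding \<O>_def by blast
    obtain z where z: "z \<in> P" "z \<in> V' V" using ne by blast
    then obtain y' where y': "y' \<in> M" "mball y' q \<subseteq> V" "z \<in> mball y' (q/2)" unfolding V'_def by blast
    have "d y' w \<le> d y' z + (d z y + d y w)"
      using triangle[of y' z w] triangle[of z y w] y y' w z by auto
    then have "d y' w < q" using w z y y' commute[of z y] by auto
    then show "w \<in> V" using y' w y by auto
  qed
  show thesis by (rule that[of V' \<O>, OF op cov' cov\<O> sub])
qed

text \<open>Uniting the first \<open>n\<close> sets with the next one increases the bound on the diameter by at most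
\<open>4 * s (Suc n)\<close>, which is less than \<open>s n - s (Suc n)\<close>. Hence the bound never exceeds \<open>2 * s 0\<close>.\<close>

lemma chain_fine_scales:
  assumes s: "\<And>n. 0 < \<delta> n" "\<And>n. \<delta> n \<le> s n" "\<And>n. s (Suc n) = \<delta> n / 9"
    and S: "\<And>m. m \<le> n \<Longrightarrow> S m \<subseteq> M \<and> chain_fine d (\<delta> m) (s m) (S m)"
  shows "chain_fine d (\<delta> n) (2 * s 0 - s n) (\<Union>m\<le>n. S m)"
proof -
  have le: "s n \<le> s 0 \<and> 0 < s n" for n
  proof (induction n)
    case (Suc n)
    then show ?case using s(1)[of n] s(2)[of n] s(3)[of n] by auto
  qed (use s(1)[of 0] s(2)[of 0] in auto)
  show ?thesis
    using S
  proof (induction n)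
    case 0
    then show ?case by auto
  next
    case (Suc n)
    have IH: "chain_fine d (\<delta> n) (2 * s 0 - s n) (\<Union>m\<le>n. S m)" using Suc by auto
    note facts = s(1)[of n] s(2)[of n] s(3)[of n] s(1)[of "Suc n"] s(2)[of "Suc n"] le[of n] le[of "Suc n"]
    have "chain_fine d (\<delta> (Suc n)) (2 * s 0 - s n + 2 * s (Suc n) + 2 * \<delta> (Suc n)) ((\<Union>m\<le>n. S m) \<union> S (Suc n))"
    proof (rule chain_fine_Un[OF _ _ IH])
      show "(\<Union>m\<le>n. S m) \<subseteq> M" using Suc.prems by (meson UN_least atMost_iff le_Suc_eq)
      show "S (Suc n) \<subseteq> M" "chain_fine d (\<delta> (Suc n)) (s (Suc n)) (S (Suc n))"
        using Suc.prems[of "Suc n"] by blast+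
    qed (use facts in auto)
    then have "chain_fine d (\<delta> (Suc n)) (2 * s 0 - s (Suc n)) ((\<Union>m\<le>n. S m) \<union> S (Suc n))"
      by (rule chain_fine_mono) (use facts in auto)
    then show ?case by (simp add: atMost_Suc Un_commute)
  qed
qed

text \<open>The \<open>i\<close>-th sets of all the local decompositions in use are united, each restricted to the preimage
of a shrunken member of the disjoint families. Over a small subset of \<open>Y\<close> the only contributions
come from members that contain it, and disjointness leaves at most one of them for each scale.\<close>

lemma fine_decomposition:
  assumes cpt: "compact_space mtopology" and f: "continuous_map mtopology Y f"
    and Y: "C_compactum Y"
    and dim: "\<And>y. y \<in> topspace Y \<Longrightarrow> covering_dim_le (subtopology mtopology {x \<in> M. f x = y}) (int k)"
    and e: "0 < e"
  obtains r G \<O> where "0 < r" "open_cover Y \<O>" "\<And>i. i \<le> k \<Longrightarrow> openin mtopology (G i)"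
    "M \<subseteq> (\<Union>i\<le>k. G i)" "\<And>P i. \<lbrakk>P \<in> \<O>; i \<le> k\<rbrakk> \<Longrightarrow> chain_fine d r e ({x \<in> M. f x \<in> P} \<inter> G i)"
proof -
  have cY: "compact_space Y" and "metrizable_space Y" and CY: "C_space Y"
    using Y by (auto simp: C_compactum_def)
  then obtain N dY where N: "Metric_space N dY" "Y = Metric_space.mtopology N dY"
    unfolding metrizable_space_def by blast
  interpret Y: Metric_space N dY by (rule N)
  have HY: "Hausdorff_space Y" using N(2) Y.Hausdorff_space_mtopology by simp
  have fM: "f x \<in> N" if "x \<in> M" for x
    using f that N(2) by (auto simp: continuous_map_def)
  have "\<exists>\<alpha> r. open_cover Y \<alpha> \<and> 0 < r \<and> (\<forall>U\<in>\<alpha>. fine_over f k r \<epsilon> U)" if "0 < \<epsilon>" for \<epsilon>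
    by (rule fine_over_cover[OF cpt f HY cY dim that]) blast+
  then obtain \<alpha> \<rho> where \<alpha>: "\<And>\<epsilon>. 0 < \<epsilon> \<Longrightarrow> open_cover Y (\<alpha> \<epsilon>)" "\<And>\<epsilon>. 0 < \<epsilon> \<Longrightarrow> 0 < \<rho> \<epsilon>"
    "\<And>\<epsilon> U. 0 < \<epsilon> \<Longrightarrow> U \<in> \<alpha> \<epsilon> \<Longrightarrow> fine_over f k (\<rho> \<epsilon>) \<epsilon> U"
    by metis
  \<comment> \<open>each scale is a ninth of the preceding gap, as the lemma on unions over all scales requires\<close>
  define s where "s = rec_nat (e/2) (\<lambda>_ t. min (\<rho> t) t / 9)"
  define \<delta> where "\<delta> n = min (\<rho> (s n)) (s n)" for n
  have s_simps: "s 0 = e/2" "\<And>n. s (Suc n) = \<delta> n / 9" by (auto simp: s_def \<delta>_def)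
  have s_pos: "0 < s n" for n
  proof (induction n)
    case (Suc n)
    then show ?case using \<alpha>(2)[of "s n"] by (simp add: s_simps \<delta>_def)
  qed (use e s_simps in simp)
  have \<delta>: "0 < \<delta> n" "\<delta> n \<le> s n" for n using \<alpha>(2)[OF s_pos[of n]] s_pos[of n] by (auto simp: \<delta>_def)
  have fine: "fine_over f k (\<delta> n) (s n) U" if "U \<in> \<alpha> (s n)" for n U
    using fine_over_mono[OF \<alpha>(3)[OF s_pos that]] by (simp add: \<delta>_def)
  obtain \<mu> :: "nat \<Rightarrow> 'b set set" where \<mu>: "\<And>n. disjoint (\<mu> n)" "\<And>n. cover_refines (\<mu> n) (\<alpha> (s n))"
    "open_cover Y (\<Union>n. \<mu> n)"
    using CY[unfolded C_space_def, rule_format, of "\<lambda>n. \<alpha> (s n)"] \<alpha>(1)[OF s_pos] by metis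
  have \<mu>_open: "\<forall>V\<in>(\<Union>n. \<mu> n). openin Y V" and \<mu>_cover: "\<Union>(\<Union>n. \<mu> n) = topspace Y"
    using \<mu>(3) unfolding open_cover_def by blast+
  obtain \<F> where \<F>: "finite \<F>" "\<F> \<subseteq> (\<Union>n. \<mu> n)" "\<Union>\<F> = topspace Y"
    using cY[unfolded compact_space, rule_format, OF conjI[OF \<mu>_open \<mu>_cover]] by (elim exE conjE)
  have "\<forall>V\<in>\<F>. openin Y V" using \<F>(2) \<mu>_open by (meson subsetD)
  with \<F>(3) have "open_cover Y \<F>" unfolding open_cover_def by simp
  then obtain V' \<O> where V': "\<And>V. V \<in> \<F> \<Longrightarrow> openin Y (V' V)" "N \<subseteq> (\<Union>V\<in>\<F>. V' V)"
    and \<O>: "open_cover Y \<O>" "\<And>P V. \<lbrakk>P \<in> \<O>; V \<in> \<F>; P \<inter> V' V \<noteq> {}\<rbrakk> \<Longrightarrow> P \<subseteq> V"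
    by (rule Y.open_cover_shrink[folded N(2), OF cY]) blast
  have "\<forall>V\<in>\<F>. \<exists>n. V \<in> \<mu> n" using \<F>(2) by blast
  then obtain n where n: "\<And>V. V \<in> \<F> \<Longrightarrow> V \<in> \<mu> (n V)" by metis
  have "fine_over f k (\<delta> (n V)) (s (n V)) V" if V: "V \<in> \<F>" for V
  proof -
    obtain U where "U \<in> \<alpha> (s (n V))" "V \<subseteq> U"
      using \<mu>(2)[of "n V"] n[OF V] unfolding cover_refines_def by blast
    then show ?thesis using fine_over_mono[OF fine] by blast
  qed
  then obtain H where H: "\<And>V i. V \<in> \<F> \<Longrightarrow> i \<le> k \<Longrightarrow> openin mtopology (H V i) \<and> chain_fine d (\<delta> (n V)) (s (n V)) (H V i)"
    "\<And>V. V \<in> \<F> \<Longrightarrow> {x \<in> M. f x \<in> V} \<subseteq> (\<Union>i\<le>k. H V i)"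
    unfolding fine_over_def by metis
  \<comment> \<open>compactness leaves finitely many scales, so the last one provides a uniform gap\<close>
  define m where "m = Max (insert 0 (n ` \<F>))"
  have m: "n V \<le> m" if "V \<in> \<F>" for V using that \<F>(1) unfolding m_def by (intro Max_ge) auto
  define G where "G i = (\<Union>V\<in>\<F>. H V i \<inter> {x \<in> topspace mtopology. f x \<in> V' V})" for i
  have V'_sub: "V' V \<subseteq> V" if V: "V \<in> \<F>" for V
  proof
    fix y assume y: "y \<in> V' V"
    then have "y \<in> topspace Y" using V'(1)[OF V] openin_subset by blast
    then obtain P where "P \<in> \<O>" "y \<in> P" using \<O>(1) unfolding open_cover_def by blast
    then show "y \<in> V" using \<O>(2)[OF _ V] y by blast
  qed
  have openG: "openin mtopology (G i)" if "i \<le> k" for i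
    unfolding G_def using H(1)[OF _ that] openin_continuous_map_preimage[OF f] V'(1) by blast
  have covG: "M \<subseteq> (\<Union>i\<le>k. G i)"
  proof
    fix x assume x: "x \<in> M"
    then obtain V where V: "V \<in> \<F>" "f x \<in> V' V" using V'(2) fM by blast
    then have "x \<in> {x \<in> M. f x \<in> V}" using V'_sub x by blast
    then obtain i where "i \<le> k" "x \<in> H V i" using H(2)[OF V(1)] by blast
    then show "x \<in> (\<Union>i\<le>k. G i)" using V x unfolding G_def by auto
  qed
  have "chain_fine d (\<delta> m) e ({x \<in> M. f x \<in> P} \<inter> G i)" if P: "P \<in> \<O>" and i: "i \<le> k" for P i
  proof (cases "P = {}")
    case False
    then obtain p where p: "p \<in> P" by blast
    define T where "T j = (\<Union>V\<in>{V \<in> \<F>. n V = j \<and> P \<subseteq> V}. H V i)" for j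
    have T: "T j \<subseteq> M \<and> chain_fine d (\<delta> j) (s j) (T j)" for j
    proof (cases "\<exists>V. V \<in> \<F> \<and> n V = j \<and> P \<subseteq> V")
      case True
      then obtain V where V: "V \<in> \<F>" "n V = j" "P \<subseteq> V" by blast
      have uniq: "W = V" if W: "W \<in> \<F>" "n W = j" "P \<subseteq> W" for W
      proof (rule ccontr)
        assume "W \<noteq> V"
        then have "disjnt W V" using pairwiseD[OF \<mu>(1)[of j]] n[OF W(1)] n[OF V(1)] W(2) V(2) by simp
        then show False using p W(3) V(3) by (auto simp: disjnt_iff)
      qed
      have "{W \<in> \<F>. n W = j \<and> P \<subseteq> W} = {V}"
      proof (intro equalityI subsetI)
        fix W assume "W \<in> {W \<in> \<F>. n W = j \<and> P \<subseteq> W}"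
        then show "W \<in> {V}" using uniq[of W] by simp
      qed (use V in simp)
      then have "T j = H V i" unfolding T_def by simp
      then show ?thesis using H(1)[OF V(1) i] V(2) openin_subset[of mtopology "H V i"] by simp
    next
      case False
      then have "{W \<in> \<F>. n W = j \<and> P \<subseteq> W} = {}" by simp
      then have "T j = {}" unfolding T_def by (simp only: UN_empty)
      then show ?thesis by simp
    qed
    have "chain_fine d (\<delta> m) (2 * s 0 - s m) (\<Union>j\<le>m. T j)"
      by (rule chain_fine_scales[of \<delta> s m T]) (rule \<delta> s_simps(2) T)+
    moreover have "{x \<in> M. f x \<in> P} \<inter> G i \<subseteq> (\<Union>j\<le>m. T j)"
    proof
      fix x assume x: "x \<in> {x \<in> M. f x \<in> P} \<inter> G i"
      then obtain V where V: "V \<in> \<F>" "x \<in> H V i" "f x \<in> V' V" unfolding G_def by blast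
      have "P \<subseteq> V" using \<O>(2)[OF P V(1)] V(3) x by blast
      then have "x \<in> T (n V)" using V unfolding T_def by blast
      then show "x \<in> (\<Union>j\<le>m. T j)" using m[OF V(1)] by blast
    qed
    ultimately show ?thesis
      by (rule chain_fine_mono) (use s_simps(1) s_pos[of m] in auto)
  qed auto
  then show thesis using that[OF \<delta>(1)[of m] \<O>(1) openG covG] by blast
qed

end

section \<open>Simplices spanned by unit vectors\<close>

text \<open>The unit vectors serve as the vertices of all complexes.\<close>

abbreviation vert :: "nat \<Rightarrow> nat \<Rightarrow>\<^sub>0 real" where
  "vert w \<equiv> Poly_Mapping.single w 1"

abbreviation coord :: "(nat \<Rightarrow>\<^sub>0 real) \<Rightarrow> nat \<Rightarrow> real" where
  "coord \<equiv> Poly_Mapping.lookup"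

abbreviation supp :: "(nat \<Rightarrow>\<^sub>0 real) \<Rightarrow> nat set" where
  "supp \<equiv> Poly_Mapping.keys"

lemma coord_scaleR: "coord (a *\<^sub>R z) w = a * coord (z :: nat \<Rightarrow>\<^sub>0 real) w"
proof -
  have "finite {i. a * coord z i \<noteq> 0}" by (rule finite_subset[OF _ finite_lookup[of z]]) auto
  then show ?thesis by (simp add: scaleR_poly_mapping_def Abs_poly_mapping_inverse)
qed

lemma coord_sum_scaleR:
  "coord (\<Sum>i\<in>A. c i *\<^sub>R z i) w = (\<Sum>i\<in>A. c i * coord (z i :: nat \<Rightarrow>\<^sub>0 real) w)"
  by (induction A rule: infinite_finite_induct) (simp_all add: lookup_add coord_scaleR)

lemma norm_eq_sum:
  fixes z :: "nat \<Rightarrow>\<^sub>0 real"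
  assumes "finite S" "supp z \<subseteq> S"
  shows "norm z = (\<Sum>w\<in>S. \<bar>coord z w\<bar>)"
proof -
  have "norm z = (\<Sum>w\<in>supp z. \<bar>coord z w\<bar>)"
    by (simp add: norm_poly_mapping_def dist_poly_mapping_def)
  also have "\<dots> = (\<Sum>w\<in>S. \<bar>coord z w\<bar>)"
    using assms by (intro sum.mono_neutral_left) (auto simp: in_keys_iff)
  finally show ?thesis .
qed

lemma abs_coord_le_norm: "\<bar>coord (z :: nat \<Rightarrow>\<^sub>0 real) w\<bar> \<le> norm z"
proof -
  have "norm z = (\<Sum>v\<in>insert w (supp z). \<bar>coord z v\<bar>)" by (rule norm_eq_sum) auto
  also have "\<dots> \<ge> \<bar>coord z w\<bar>" by (rule member_le_sum) auto
  finally show ?thesis .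
qed

lemma bounded_linear_coord: "bounded_linear (\<lambda>z :: nat \<Rightarrow>\<^sub>0 real. coord z w)"
  by (rule bounded_linear_intro[where K=1]) (use abs_coord_le_norm in \<open>auto simp: lookup_add coord_scaleR\<close>)

lemma expand_vert:
  assumes "finite S" "supp z \<subseteq> S" shows "z = (\<Sum>w\<in>S. coord z w *\<^sub>R vert w)"
proof (rule poly_mapping_eqI)
  fix v
  have "coord (\<Sum>w\<in>S. coord z w *\<^sub>R vert w) v = (\<Sum>w\<in>S. if w = v then coord z w else 0)"
    unfolding coord_sum_scaleR by (rule sum.cong) (auto simp: lookup_single)
  also have "\<dots> = (if v \<in> S then coord z v else 0)" using assms by simp
  also have "\<dots> = coord z v" using assms by (auto simp: in_keys_iff)
  finally show "coord z v = coord (\<Sum>w\<in>S. coord z w *\<^sub>R vert w) v" by simp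
qed

definition std_simplex :: "nat set \<Rightarrow> (nat \<Rightarrow>\<^sub>0 real) set" where
  "std_simplex S = {z. supp z \<subseteq> S \<and> (\<forall>w. 0 \<le> coord z w) \<and> (\<Sum>w\<in>S. coord z w) = 1}"

lemma std_simplex_subset_iff:
  assumes "finite S" "T \<subseteq> S" shows "z \<in> std_simplex T \<longleftrightarrow> z \<in> std_simplex S \<and> supp z \<subseteq> T"
proof -
  have "(\<Sum>w\<in>T. coord z w) = (\<Sum>w\<in>S. coord z w)" if "supp z \<subseteq> T"
    using assms that by (intro sum.mono_neutral_left) (auto simp: in_keys_iff)
  then show ?thesis using assms by (auto simp: std_simplex_def)
qed

lemma convex_std_simplex: "convex (std_simplex S)"
proof (rule convexI)
  fix x y :: "nat \<Rightarrow>\<^sub>0 real" and u v :: real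
  assume h: "x \<in> std_simplex S" "y \<in> std_simplex S" "0 \<le> u" "0 \<le> v" "u + v = 1"
  have l: "coord (u *\<^sub>R x + v *\<^sub>R y) w = u * coord x w + v * coord y w" for w
    by (simp add: lookup_add coord_scaleR)
  have "supp (u *\<^sub>R x + v *\<^sub>R y) \<subseteq> supp x \<union> supp y"
  proof
    fix w assume "w \<in> supp (u *\<^sub>R x + v *\<^sub>R y)"
    then have "u * coord x w + v * coord y w \<noteq> 0" unfolding in_keys_iff l .
    then show "w \<in> supp x \<union> supp y" by (auto simp: in_keys_iff)
  qed
  moreover have "(\<Sum>w\<in>S. coord (u *\<^sub>R x + v *\<^sub>R y) w) = 1"
    using h by (simp add: l sum.distrib flip: sum_distrib_left) (simp add: std_simplex_def)
  ultimately show "u *\<^sub>R x + v *\<^sub>R y \<in> std_simplex S"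
    using h by (auto simp: std_simplex_def l)
qed

lemma vert_in_std_simplex: "finite S \<Longrightarrow> w \<in> S \<Longrightarrow> vert w \<in> std_simplex S"
  by (auto simp: std_simplex_def lookup_single when_def)

lemma std_simplex_eq_hull:
  assumes "finite S" shows "std_simplex S = convex hull (vert ` S)"
proof
  show "convex hull (vert ` S) \<subseteq> std_simplex S"
    by (rule hull_minimal) (use assms vert_in_std_simplex convex_std_simplex in auto)
  show "std_simplex S \<subseteq> convex hull (vert ` S)"
  proof
    fix z assume z: "z \<in> std_simplex S"
    have "(\<Sum>w\<in>S. coord z w *\<^sub>R vert w) \<in> convex hull (vert ` S)"
      by (rule convex_sum) (use assms z in \<open>auto simp: std_simplex_def hull_inc\<close>)
    then show "z \<in> convex hull (vert ` S)" using expand_vert[OF assms] z by (simp add: std_simplex_def)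
  qed
qed

lemma vert_inj: "inj vert"
proof (rule injI)
  fix v w assume "vert v = vert w"
  then have "coord (vert v) v = coord (vert w) v" by simp
  then show "v = w" by (auto simp: lookup_single when_def split: if_splits)
qed

lemma affine_independent_vert:
  assumes "finite S" shows "\<not> affine_dependent (vert ` S)"
proof
  assume "affine_dependent (vert ` S)"
  then obtain U v where U: "v \<in> vert ` S" "U v \<noteq> 0" "(\<Sum>x\<in>vert ` S. U x *\<^sub>R x) = 0"
    unfolding affine_dependent_explicit_finite[OF finite_imageI[OF assms]] by blast
  then obtain w where w: "w \<in> S" "v = vert w" by blast
  have "(\<Sum>i\<in>S. U (vert i) *\<^sub>R vert i) = 0"
    using U(3) vert_inj by (subst (asm) sum.reindex) (auto intro: inj_on_subset simp: comp_def)
  then have "coord (\<Sum>i\<in>S. U (vert i) *\<^sub>R vert i) w = 0" by simp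
  moreover have "coord (\<Sum>i\<in>S. U (vert i) *\<^sub>R vert i) w = (\<Sum>i\<in>S. if i = w then U (vert i) else 0)"
    unfolding coord_sum_scaleR by (rule sum.cong) (auto simp: lookup_single)
  ultimately show False using w U(2) assms by simp
qed

lemma std_simplex_face_of:
  assumes "finite S" "T \<subseteq> S" shows "std_simplex T face_of std_simplex S"
  unfolding face_of_def
proof (intro conjI ballI impI)
  show "std_simplex T \<subseteq> std_simplex S" using std_simplex_subset_iff[OF assms] by blast
  show "convex (std_simplex T)" by (rule convex_std_simplex)
  fix a b x assume ab: "a \<in> std_simplex S" "b \<in> std_simplex S" and x: "x \<in> std_simplex T" "x \<in> open_segment a b"
  obtain u where u: "0 < u" "u < 1" "x = (1 - u) *\<^sub>R a + u *\<^sub>R b" using x(2) by (auto simp: in_segment)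
  have "coord a w = 0 \<and> coord b w = 0" if w: "w \<notin> T" for w
  proof -
    have "coord x w = 0" using x(1) w by (auto simp: std_simplex_def in_keys_iff)
    then have "(1 - u) * coord a w + u * coord b w = 0" by (simp add: u(3) lookup_add coord_scaleR)
    moreover have "0 \<le> (1 - u) * coord a w" "0 \<le> u * coord b w" using ab u by (auto simp: std_simplex_def)
    ultimately have "(1 - u) * coord a w = 0" "u * coord b w = 0" by linarith+
    then show ?thesis using u by simp
  qed
  then have "supp a \<subseteq> T" "supp b \<subseteq> T" by (auto simp: in_keys_iff)
  then show "a \<in> std_simplex T" "b \<in> std_simplex T" using std_simplex_subset_iff[OF assms] ab by auto
qed

text \<open>Let \<open>T\<close> be the set of all coordinates that are positive somewhere on \<open>F\<close>. A point of \<open>F\<close> with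
positive \<open>w\<close>-th coordinate is the vertex \<open>w\<close> or lies inside a segment that ends there, so the vertex
\<open>w\<close> belongs to the face \<open>F\<close>.\<close>

lemma face_of_std_simplexE:
  assumes S: "finite S" and F: "F face_of std_simplex S"
  obtains T where "T \<subseteq> S" "F = std_simplex T"
proof
  let ?T = "\<Union>z\<in>F. supp z"
  have FS: "F \<subseteq> std_simplex S" using F by (rule face_of_imp_subset)
  show TS: "?T \<subseteq> S" using FS by (auto simp: std_simplex_def)
  have "vert w \<in> F" if w: "w \<in> ?T" for w
  proof -
    obtain z where z: "z \<in> F" "w \<in> supp z" using w by blast
    have zS: "z \<in> std_simplex S" using z FS by blast
    have wS: "w \<in> S" using w TS by blast
    have nn: "\<And>v. 0 \<le> coord z v" and sum1: "(\<Sum>v\<in>S. coord z v) = 1" and kz: "supp z \<subseteq> S"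
      using zS by (auto simp: std_simplex_def)
    define t where "t = coord z w"
    have t0: "0 < t" using z(2) nn[of w] by (simp add: t_def in_keys_iff)
    have split: "t + (\<Sum>v\<in>S - {w}. coord z v) = 1"
      using sum1 S wS by (simp add: t_def sum.remove)
    have rest: "z = t *\<^sub>R vert w + (\<Sum>v\<in>S - {w}. coord z v *\<^sub>R vert v)"
      using expand_vert[OF S kz] S wS by (simp add: t_def sum.remove)
    show ?thesis
    proof (cases "t = 1")
      case True
      then have "(\<Sum>v\<in>S - {w}. coord z v) = 0" using split by simp
      then have "\<forall>v\<in>S - {w}. coord z v = 0" using S nn by (subst (asm) sum_nonneg_eq_0_iff) auto
      then have "z = vert w" using rest True by simp
      then show ?thesis using z by simp
    next
      case False
      have "0 \<le> (\<Sum>v\<in>S - {w}. coord z v)" using nn by (rule sum_nonneg)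
      then have t1: "t < 1" using split False by linarith
      define b where "b = (\<Sum>v\<in>S - {w}. (coord z v / (1 - t)) *\<^sub>R vert v)"
      have "(\<Sum>v\<in>S - {w}. coord z v / (1 - t)) = 1"
        using split t1 by (simp add: field_simps flip: sum_divide_distrib)
      then have bS: "b \<in> std_simplex S"
        unfolding b_def by (intro convex_sum) (use S nn t1 convex_std_simplex vert_in_std_simplex in auto)
      have zb: "z = (1 - t) *\<^sub>R b + t *\<^sub>R vert w"
        unfolding b_def scaleR_sum_right using t1 by (subst rest) simp
      have "coord b w = 0"
        unfolding b_def coord_sum_scaleR by (rule sum.neutral) (auto simp: lookup_single)
      then have "b \<noteq> vert w" by (auto simp: lookup_single)
      then have "z \<in> open_segment b (vert w)" using zb t0 t1 by (auto simp: in_segment)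
      then show ?thesis using F z bS vert_in_std_simplex[OF S wS] unfolding face_of_def by blast
    qed
  qed
  then have "convex hull (vert ` ?T) \<subseteq> F"
    using face_of_imp_convex[OF F] by (intro hull_minimal) auto
  moreover have "finite ?T" using TS S finite_subset by blast
  ultimately have "std_simplex ?T \<subseteq> F" by (simp add: std_simplex_eq_hull)
  moreover have "F \<subseteq> std_simplex ?T" using std_simplex_subset_iff[OF S TS] FS by blast
  ultimately show "F = std_simplex ?T" by blast
qed

lemma std_simplex_Int:
  assumes "finite S" "finite T" shows "std_simplex S \<inter> std_simplex T = std_simplex (S \<inter> T)"
proof (rule set_eqI)
  fix z
  have "z \<in> std_simplex (S \<inter> T) \<longleftrightarrow> z \<in> std_simplex S \<and> supp z \<subseteq> S \<inter> T"
    "z \<in> std_simplex (S \<inter> T) \<longleftrightarrow> z \<in> std_simplex T \<and> supp z \<subseteq> S \<inter> T"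
    using std_simplex_subset_iff[OF assms(1), of "S \<inter> T" z] std_simplex_subset_iff[OF assms(2), of "S \<inter> T" z]
    by simp_all
  moreover have "supp z \<subseteq> S" if "z \<in> std_simplex S" for S using that by (simp add: std_simplex_def)
  ultimately show "z \<in> std_simplex S \<inter> std_simplex T \<longleftrightarrow> z \<in> std_simplex (S \<inter> T)" by blast
qed

lemma finite_complex_std_simplices:
  assumes fin: "finite \<S>" "\<And>S. S \<in> \<S> \<Longrightarrow> finite S" and down: "\<And>S T. \<lbrakk>S \<in> \<S>; T \<subseteq> S\<rbrakk> \<Longrightarrow> T \<in> \<S>"
  shows "finite_complex (std_simplex ` \<S>)"
  unfolding finite_complex_def
proof (intro conjI ballI allI impI)
  show "finite (std_simplex ` \<S>)" using fin by simp
  fix A assume "A \<in> std_simplex ` \<S>"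
  then obtain S where S: "S \<in> \<S>" "A = std_simplex S" by blast
  show "\<exists>C. finite C \<and> \<not> affine_dependent C \<and> A = convex hull C"
    using fin(2)[OF S(1)] affine_independent_vert std_simplex_eq_hull S(2) by (intro exI[of _ "vert ` S"]) simp
  show "F \<in> std_simplex ` \<S>" if F: "F face_of A" for F
  proof -
    obtain T where "T \<subseteq> S" "F = std_simplex T"
      using face_of_std_simplexE[OF fin(2)[OF S(1)] F[unfolded S(2)]] by blast
    then show ?thesis using down[OF S(1)] by blast
  qed
  fix B assume "B \<in> std_simplex ` \<S>"
  then obtain T where T: "T \<in> \<S>" "B = std_simplex T" by blast
  have "A \<inter> B = std_simplex (S \<inter> T)" using std_simplex_Int fin(2) S T by simp
  then show "(A \<inter> B) face_of A" using std_simplex_face_of[OF fin(2)[OF S(1)]] S(2) by simp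
qed

section \<open>Maps induced by maps of the vertices\<close>

text \<open>The linear extension of a map of vertices; the index set only serves to keep the sum finite.\<close>

definition vertex_map :: "(nat \<Rightarrow> nat) \<Rightarrow> nat set \<Rightarrow> (nat \<Rightarrow>\<^sub>0 real) \<Rightarrow> (nat \<Rightarrow>\<^sub>0 real)" where
  "vertex_map \<pi> I z = (\<Sum>w\<in>I. coord z w *\<^sub>R vert (\<pi> w))"

lemma bounded_linear_vertex_map: "bounded_linear (vertex_map \<pi> I)"
  unfolding vertex_map_def
  by (intro bounded_linear_sum bounded_linear_scaleR_const bounded_linear_coord)

lemma vertex_map_vert: "finite I \<Longrightarrow> w \<in> I \<Longrightarrow> vertex_map \<pi> I (vert w) = vert (\<pi> w)"
proof -
  assume "finite I" "w \<in> I"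
  moreover have "vertex_map \<pi> I (vert w) = (\<Sum>i\<in>I. if i = w then vert (\<pi> i) else 0)"
    unfolding vertex_map_def by (rule sum.cong) (auto simp: lookup_single)
  ultimately show ?thesis by simp
qed

lemma vertex_map_std_simplex:
  assumes "finite I" "S \<subseteq> I" shows "vertex_map \<pi> I ` std_simplex S = std_simplex (\<pi> ` S)"
proof -
  have fin: "finite S" using assms finite_subset by blast
  have "vertex_map \<pi> I ` (convex hull (vert ` S)) = convex hull (vertex_map \<pi> I ` vert ` S)"
    by (intro convex_hull_linear_image bounded_linear.linear bounded_linear_vertex_map)
  also have "vertex_map \<pi> I ` vert ` S = vert ` \<pi> ` S"
    unfolding image_image by (rule image_cong) (use vertex_map_vert[OF assms(1)] assms(2) in auto)
  finally show ?thesis using fin by (simp add: std_simplex_eq_hull)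
qed

lemma coord_vertex_map:
  assumes "finite I" shows "coord (vertex_map \<pi> I z) v = (\<Sum>w\<in>{w \<in> I. \<pi> w = v}. coord z w)"
proof -
  have "coord (vertex_map \<pi> I z) v = (\<Sum>w\<in>I. if \<pi> w = v then coord z w else 0)"
    unfolding vertex_map_def coord_sum_scaleR by (rule sum.cong) (auto simp: lookup_single)
  then show ?thesis using assms by (simp add: sum.inter_filter)
qed

lemma simplicial_vertex_map:
  assumes I: "finite I" "\<And>S. S \<in> \<S> \<Longrightarrow> S \<subseteq> I" and im: "\<And>S. S \<in> \<S> \<Longrightarrow> \<pi> ` S \<in> \<T>"
  shows "simplicial_map_on (std_simplex ` \<S>) (std_simplex ` \<T>) (vertex_map \<pi> I)"
proof -
  have "linear (vertex_map \<pi> I)" by (rule bounded_linear.linear[OF bounded_linear_vertex_map])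
  then have "vertex_map \<pi> I ((1 - t) *\<^sub>R x + t *\<^sub>R y) = (1 - t) *\<^sub>R vertex_map \<pi> I x + t *\<^sub>R vertex_map \<pi> I y"
    for x y t by (simp add: linear_add linear_scale)
  moreover have "vertex_map \<pi> I ` std_simplex S \<in> std_simplex ` \<T>" if "S \<in> \<S>" for S
    using vertex_map_std_simplex[OF I(1) I(2)[OF that]] im[OF that] by simp
  ultimately show ?thesis unfolding simplicial_map_on_def by blast
qed

text \<open>This is Kolmogorov's construction with \<open>k + 1\<close> shifted cubical grids. Shifting the grid along the
diagonal by multiples of \<open>1 / (k + 1)\<close> of its mesh, remove from it walls of relative thickness
\<open>1 / (k + 1)\<close>. A coordinate of a given point lies in a wall for only one of the shifts, so that at
most \<open>k\<close> shifts are lost, and for the remaining one the point lies in a cube. The cubes of one grid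
are separated by the walls.\<close>

lemma (in Metric_space) fine_dim_le_coordinates:
  assumes A: "A \<subseteq> M" and T: "finite T" "card T \<le> k"
    and g: "\<And>w x y. \<lbrakk>w \<in> T; x \<in> A; y \<in> A\<rbrakk> \<Longrightarrow> \<bar>g w x - g w y\<bar> \<le> d x y"
    and C: "0 < C" "\<And>x y \<eta>. \<lbrakk>x \<in> A; y \<in> A; 0 < \<eta>; \<And>w. w \<in> T \<Longrightarrow> \<bar>g w x - g w y\<bar> \<le> \<eta>\<rbrakk> \<Longrightarrow> d x y \<le> C * \<eta>"
  shows "fine_dim_le d k A"
  unfolding fine_dim_le_def
proof (intro allI impI)
  fix e :: real assume e: "0 < e"
  define K where "K = real k + 1"
  have K: "K > 0" by (simp add: K_def)
  define h where "h = e / C"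
  have h: "h > 0" "C * h = e" using e C by (auto simp: h_def)
  \<comment> \<open>the position of the \<open>w\<close>-th coordinate relative to the \<open>i\<close>-th grid, in units of the mesh\<close>
  define \<tau> where "\<tau> i w x = g w x / h - (real i + 1) / K" for i w x
  define B where "B i = {x \<in> A. \<forall>w\<in>T. frac (\<tau> i w x) < real k / K}" for i
  have "A \<subseteq> (\<Union>i\<le>k. B i)"
  proof
    fix x assume x: "x \<in> A"
    have bad: "i = nat (\<lfloor>K * (g w x / h)\<rfloor> mod (int k + 1))"
      if i: "i \<le> k" "\<not> frac (\<tau> i w x) < real k / K" for i w
    proof -
      define n where "n = \<lfloor>\<tau> i w x\<rfloor>"
      have "real_of_int n + real k / K \<le> \<tau> i w x" "\<tau> i w x < real_of_int n + 1"
        using i(2) by (auto simp: frac_def n_def)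
      then have "K * (real_of_int n + real k / K) \<le> K * \<tau> i w x" "K * \<tau> i w x < K * (real_of_int n + 1)"
        using K by auto
      moreover have "K * \<tau> i w x = K * (g w x / h) - (real i + 1)"
        using K by (simp add: \<tau>_def right_diff_distrib)
      moreover have "K * (real_of_int n + real k / K) = K * real_of_int n + real k"
        using K by (simp add: distrib_left)
      moreover have "K * (real_of_int n + 1) = K * real_of_int n + real k + 1"
        by (simp add: K_def distrib_left)
      ultimately have "K * real_of_int n + real k + real i + 1 \<le> K * (g w x / h)"
        "K * (g w x / h) < K * real_of_int n + real k + real i + 2" by linarith+
      \<comment> \<open>the shift whose wall contains the coordinate can be read off from its value\<close>
      then have "\<lfloor>K * (g w x / h)\<rfloor> = (int k + 1) * (n + 1) + int i"
        unfolding floor_eq_iff K_def by (simp add: algebra_simps)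
      then have "\<lfloor>K * (g w x / h)\<rfloor> mod (int k + 1) = int i" using i(1) by simp
      then show ?thesis by simp
    qed
    let ?bad = "(\<lambda>w. nat (\<lfloor>K * (g w x / h)\<rfloor> mod (int k + 1))) ` T"
    have "card ?bad < card {..k}" using card_image_le[OF T(1)] T(2) by (metis card_atMost le_imp_less_Suc order_trans)
    then have "\<not> {..k} \<subseteq> ?bad" using T(1) card_mono by (metis finite_imageI not_le)
    then obtain i where "i \<le> k" "i \<notin> ?bad" by auto
    then have "x \<in> B i" using bad x unfolding B_def by blast
    then show "x \<in> (\<Union>i\<le>k. B i)" using \<open>i \<le> k\<close> by blast
  qed
  moreover have "chain_fine d (h / K) e (B i)" for i
  proof (rule chain_fine_label)
    let ?g = "\<lambda>x. restrict (\<lambda>w. \<lfloor>\<tau> i w x\<rfloor>) T"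
    have step: "\<lfloor>\<tau> i w x\<rfloor> \<le> \<lfloor>\<tau> i w y\<rfloor>" if xy: "x \<in> B i" "y \<in> B i" "d x y < h / K" and w: "w \<in> T" for x y w
    proof (rule ccontr)
      assume "\<not> \<lfloor>\<tau> i w x\<rfloor> \<le> \<lfloor>\<tau> i w y\<rfloor>"
      then have "real_of_int \<lfloor>\<tau> i w y\<rfloor> + 1 \<le> real_of_int \<lfloor>\<tau> i w x\<rfloor>" by linarith
      then have "real_of_int \<lfloor>\<tau> i w y\<rfloor> + 1 \<le> \<tau> i w x" by linarith
      moreover have "\<tau> i w y < real_of_int \<lfloor>\<tau> i w y\<rfloor> + real k / K"
        using xy(2) w by (auto simp: B_def frac_def)
      moreover have "real k / K = 1 - 1 / K" using K by (simp add: K_def field_simps)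
      ultimately have "1 / K < \<tau> i w x - \<tau> i w y" by linarith
      also have "\<tau> i w x - \<tau> i w y = (g w x - g w y) / h" by (simp add: \<tau>_def diff_divide_distrib)
      also have "\<dots> \<le> d x y / h"
        using g[OF w, of x y] xy h by (intro divide_right_mono) (auto simp: B_def)
      also have "\<dots> < (h / K) / h" using xy(3) h by (intro divide_strict_right_mono) auto
      also have "\<dots> = 1 / K" using h by simp
      finally show False by simp
    qed
    show "?g x = ?g y" if "x \<in> B i" "y \<in> B i" "d x y < h / K" for x y
      using step[of x y] step[of y x] that by (intro restrict_ext antisym) (auto simp: commute)
    show "d x y \<le> e" if xy: "x \<in> B i" "y \<in> B i" and eq: "?g x = ?g y" for x y
    proof -
      have "\<bar>g w x - g w y\<bar> \<le> h" if w: "w \<in> T" for w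
      proof -
        have "\<lfloor>\<tau> i w x\<rfloor> = \<lfloor>\<tau> i w y\<rfloor>" using fun_cong[OF eq, of w] w by simp
        then have "\<bar>\<tau> i w x - \<tau> i w y\<bar> < 1" by linarith
        moreover have "\<tau> i w x - \<tau> i w y = (g w x - g w y) / h" by (simp add: \<tau>_def diff_divide_distrib)
        ultimately show ?thesis using h by (simp add: field_simps)
      qed
      then show ?thesis using C(2)[of x y h] xy h by (auto simp: B_def)
    qed
  qed
  moreover have "B i \<subseteq> A" for i by (auto simp: B_def)
  moreover have "h / K > 0" using h K by simp
  ultimately show "\<exists>r>0. \<exists>B. A \<subseteq> (\<Union>i\<le>k. B i) \<and> (\<forall>i\<le>k. B i \<subseteq> A \<and> chain_fine d r e (B i))" by blast
qed

text \<open>On a fibre, the coordinates at the vertices over \<open>v\<close> have the prescribed sum \<open>coord y v\<close>. Hence one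
of them is determined by the others, for each \<open>v\<close> in the image, and at most \<open>k\<close> coordinates remain
free.\<close>

lemma fine_dim_le_fibre_std_simplex:
  assumes I: "finite I" "S \<subseteq> I" and card: "card S \<le> k + card (\<pi> ` S)"
  shows "fine_dim_le dist k {z \<in> std_simplex S. vertex_map \<pi> I z = y}"
proof -
  define A where "A = {z \<in> std_simplex S. vertex_map \<pi> I z = y}"
  have S: "finite S" using I finite_subset by blast
  \<comment> \<open>\<open>\<sigma> v\<close> is the vertex over \<open>v\<close> whose coordinate is expressed by the others\<close>
  define \<sigma> where "\<sigma> = inv_into S \<pi>"
  have \<sigma>: "\<sigma> v \<in> S" "\<pi> (\<sigma> v) = v" if "v \<in> \<pi> ` S" for v
    using that by (auto simp: \<sigma>_def inv_into_into f_inv_into_f)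
  define R where "R = \<sigma> ` \<pi> ` S"
  define T where "T = S - R"
  have RS: "R \<subseteq> S" using \<sigma>(1) by (auto simp: R_def)
  have fin: "finite R" "finite T" using S by (auto simp: R_def T_def)
  have "card R = card (\<pi> ` S)"
    unfolding R_def by (rule card_image) (simp add: \<sigma>_def inj_on_inv_into)
  then have cT: "card T \<le> k" using card RS fin(1) by (simp add: T_def card_Diff_subset)
  have dep: "coord z (\<sigma> v) = coord y v - (\<Sum>u\<in>{u \<in> T. \<pi> u = v}. coord z u)"
    if z: "z \<in> A" and v: "v \<in> \<pi> ` S" for z v
  proof -
    have zS: "supp z \<subseteq> S" and zy: "vertex_map \<pi> I z = y" using z by (auto simp: A_def std_simplex_def)
    have "coord y v = (\<Sum>u\<in>{u \<in> I. \<pi> u = v}. coord z u)"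
      using coord_vertex_map[OF I(1), of \<pi> z v] zy by simp
    also have "\<dots> = (\<Sum>u\<in>{u \<in> S. \<pi> u = v}. coord z u)"
      using I zS by (intro sum.mono_neutral_right) (auto simp: in_keys_iff)
    also have "{u \<in> S. \<pi> u = v} = insert (\<sigma> v) {u \<in> T. \<pi> u = v}"
      using \<sigma> v by (auto simp: T_def R_def)
    also have "(\<Sum>u\<in>insert (\<sigma> v) {u \<in> T. \<pi> u = v}. coord z u) = coord z (\<sigma> v) + (\<Sum>u\<in>{u \<in> T. \<pi> u = v}. coord z u)"
      using fin v by (intro sum.insert) (auto simp: T_def R_def)
    finally show ?thesis by simp
  qed
  define C where "C = real (card T) + real (card R) * real (card T) + 1"
  have "fine_dim_le dist k A"
  proof (rule Met_TC.fine_dim_le_coordinates[where T=T and g="\<lambda>w z. coord z w" and C=C])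
    show "0 < C" by (simp add: C_def add_nonneg_pos)
    fix x z :: "nat \<Rightarrow>\<^sub>0 real" and \<eta> :: real
    assume xz: "x \<in> A" "z \<in> A" and \<eta>: "0 < \<eta>" and le: "\<And>w. w \<in> T \<Longrightarrow> \<bar>coord x w - coord z w\<bar> \<le> \<eta>"
    have "supp (x - z) \<subseteq> S" using keys_diff[of x z] xz by (auto simp: A_def std_simplex_def)
    then have "dist x z = (\<Sum>w\<in>S. \<bar>coord x w - coord z w\<bar>)"
      unfolding dist_norm by (subst norm_eq_sum[OF S]) (simp_all add: lookup_minus)
    also have "\<dots> = (\<Sum>w\<in>T. \<bar>coord x w - coord z w\<bar>) + (\<Sum>w\<in>R. \<bar>coord x w - coord z w\<bar>)"
      using sum.subset_diff[OF RS S] by (simp add: T_def)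
    also have "(\<Sum>w\<in>T. \<bar>coord x w - coord z w\<bar>) \<le> real (card T) * \<eta>"
      using sum_bounded_above[of T "\<lambda>w. \<bar>coord x w - coord z w\<bar>" \<eta>] le by simp
    also have "(\<Sum>w\<in>R. \<bar>coord x w - coord z w\<bar>) \<le> real (card R) * (real (card T) * \<eta>)"
    proof (rule sum_bounded_above)
      fix w assume "w \<in> R"
      then obtain v where v: "v \<in> \<pi> ` S" "w = \<sigma> v" by (auto simp: R_def)
      have "\<bar>coord x w - coord z w\<bar> = \<bar>\<Sum>u\<in>{u \<in> T. \<pi> u = v}. coord x u - coord z u\<bar>"
        unfolding v(2) dep[OF xz(1) v(1)] dep[OF xz(2) v(1)] by (simp add: sum_subtractf)
      also have "\<dots> \<le> (\<Sum>u\<in>{u \<in> T. \<pi> u = v}. \<bar>coord x u - coord z u\<bar>)" by (rule sum_abs)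
      also have "\<dots> \<le> (\<Sum>u\<in>T. \<bar>coord x u - coord z u\<bar>)" using fin by (intro sum_mono2) auto
      also have "\<dots> \<le> real (card T) * \<eta>"
        using sum_bounded_above[of T "\<lambda>w. \<bar>coord x w - coord z w\<bar>" \<eta>] le by simp
      finally show "\<bar>coord x w - coord z w\<bar> \<le> real (card T) * \<eta>" .
    qed
    finally have "dist x z \<le> real (card T) * \<eta> + real (card R) * (real (card T) * \<eta>)" by simp
    also have "\<dots> \<le> C * \<eta>" using \<eta> by (simp add: C_def algebra_simps)
    finally show "dist x z \<le> C * \<eta>" .
  next
    fix w and x z :: "nat \<Rightarrow>\<^sub>0 real"
    show "\<bar>coord x w - coord z w\<bar> \<le> dist x z"
      using abs_coord_le_norm[of "x - z" w] by (simp add: lookup_minus dist_norm)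
  qed (use fin cT in auto)
  then show ?thesis by (simp add: A_def)
qed

lemma covering_dim_fibre_vertex_map:
  assumes I: "finite I" and \<S>: "finite \<S>" "\<And>S. S \<in> \<S> \<Longrightarrow> S \<subseteq> I"
    and card: "\<And>S. S \<in> \<S> \<Longrightarrow> card S \<le> k + card (\<pi> ` S)"
  shows "covering_dim (top_of_set {z \<in> \<Union>(std_simplex ` \<S>). vertex_map \<pi> I z = y}) \<le> ereal (real k)"
proof -
  define F where "F = {z \<in> \<Union>(std_simplex ` \<S>). vertex_map \<pi> I z = y}"
  interpret F: Submetric UNIV dist F by unfold_locales simp
  have top: "F.sub.mtopology = top_of_set F" using F.mtopology_submetric by simp
  have finS: "finite S" if "S \<in> \<S>" for S using \<S>(2)[OF that] I finite_subset by blast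
  have "compact (std_simplex S)" if "S \<in> \<S>" for S
    using finS[OF that] by (simp add: std_simplex_eq_hull finite_imp_compact_convex_hull)
  then have "compact (\<Union>(std_simplex ` \<S>))" using \<S>(1) by blast
  moreover have "closed {z. vertex_map \<pi> I z = y}"
    by (intro closed_Collect_eq linear_continuous_on bounded_linear_vertex_map continuous_on_const)
  ultimately have "compact (\<Union>(std_simplex ` \<S>) \<inter> {z. vertex_map \<pi> I z = y})" by (rule compact_Int_closed)
  moreover have "\<Union>(std_simplex ` \<S>) \<inter> {z. vertex_map \<pi> I z = y} = F" by (auto simp: F_def)
  ultimately have "compact F" by simp
  then have cF: "compact_space F.sub.mtopology" unfolding top by (simp add: compact_space_subtopology)
  have "fine_dim_le dist k (\<Union>S\<in>\<S>. {z \<in> std_simplex S. vertex_map \<pi> I z = y})"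
    using fine_dim_le_fibre_std_simplex[OF I \<S>(2) card] by (intro Met_TC.fine_dim_le_Union[OF \<S>(1)]) simp
  moreover have "(\<Union>S\<in>\<S>. {z \<in> std_simplex S. vertex_map \<pi> I z = y}) = F" by (auto simp: F_def)
  ultimately have "fine_dim_le dist k F" by simp
  then have "covering_dim_le (top_of_set F) (int k)"
    using F.sub.covering_dim_le_if_fine_dim_le[OF cF] top by simp
  then show ?thesis unfolding F_def by (rule covering_dim_leI)
qed

lemma dimensional_vertex_map:
  assumes I: "finite I" and \<S>: "finite \<S>" "\<And>S. S \<in> \<S> \<Longrightarrow> S \<subseteq> I"
    and card: "\<And>S. S \<in> \<S> \<Longrightarrow> card S \<le> k + card (\<pi> ` S)" and im: "\<And>S. S \<in> \<S> \<Longrightarrow> \<pi> ` S \<in> \<T>"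
  shows "dimensional_map k (polyhedron_of (std_simplex ` \<S>)) (polyhedron_of (std_simplex ` \<T>)) (vertex_map \<pi> I)"
  unfolding dimensional_map_def polyhedron_of_def
proof (intro conjI ballI)
  have "vertex_map \<pi> I z \<in> \<Union>(std_simplex ` \<T>)" if z: "z \<in> \<Union>(std_simplex ` \<S>)" for z
  proof -
    obtain S where S: "S \<in> \<S>" "z \<in> std_simplex S" using z by blast
    then have "vertex_map \<pi> I z \<in> std_simplex (\<pi> ` S)" using vertex_map_std_simplex[OF I \<S>(2)] by blast
    then show ?thesis using im[OF S(1)] by blast
  qed
  then show "continuous_map (top_of_set (\<Union>(std_simplex ` \<S>))) (top_of_set (\<Union>(std_simplex ` \<T>))) (vertex_map \<pi> I)"
    by (auto simp: continuous_map_in_subtopology intro!: linear_continuous_on bounded_linear_vertex_map)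
  fix y
  have "subtopology (top_of_set (\<Union>(std_simplex ` \<S>))) {z \<in> topspace (top_of_set (\<Union>(std_simplex ` \<S>))). vertex_map \<pi> I z = y}
      = top_of_set {z \<in> \<Union>(std_simplex ` \<S>). vertex_map \<pi> I z = y}"
    unfolding subtopology_subtopology by (rule arg_cong[where f="subtopology euclidean"]) auto
  then show "covering_dim (subtopology (top_of_set (\<Union>(std_simplex ` \<S>)))
      {z \<in> topspace (top_of_set (\<Union>(std_simplex ` \<S>))). vertex_map \<pi> I z = y}) \<le> ereal (real k)"
    using covering_dim_fibre_vertex_map[OF I \<S> card] by simp
qed

text \<open>The polyhedron is a fibre of the map that sends all vertices to a single one.\<close>

lemma covering_dim_polyhedron:
  assumes I: "finite I" and \<S>: "finite \<S>" "\<And>S. S \<in> \<S> \<Longrightarrow> S \<subseteq> I"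
    and card: "\<And>S. S \<in> \<S> \<Longrightarrow> card S \<le> n + 1"
  shows "covering_dim (polyhedron_of (std_simplex ` \<S>)) \<le> ereal (real n)"
proof -
  have "vertex_map (\<lambda>_. 0) I z = vert 0" if z: "z \<in> std_simplex S" and S: "S \<in> \<S>" for z S
  proof -
    have "z \<in> std_simplex I" using std_simplex_subset_iff[OF I \<S>(2)[OF S]] z by blast
    then show ?thesis
      unfolding vertex_map_def scaleR_sum_left[symmetric] by (simp add: std_simplex_def)
  qed
  then have eq: "{z \<in> \<Union>(std_simplex ` \<S>). vertex_map (\<lambda>_. 0) I z = vert 0} = \<Union>(std_simplex ` \<S>)" by blast
  have "card S \<le> n + card ((\<lambda>_. 0::nat) ` S)" if S: "S \<in> \<S>" for S
  proof (cases "S = {}")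
    case False
    then have "(\<lambda>_. 0::nat) ` S = {0}" by auto
    then show ?thesis using card[OF S] by simp
  qed simp
  from covering_dim_fibre_vertex_map[OF I \<S> this, of "vert 0"] show ?thesis
    unfolding eq polyhedron_of_def by simp
qed

section \<open>Nerves of partitions of unity\<close>

definition nerve :: "'a topology \<Rightarrow> nat set \<Rightarrow> (nat \<Rightarrow> 'a \<Rightarrow> real) \<Rightarrow> nat set set" where
  "nerve X I \<psi> = {S. \<exists>x\<in>topspace X. S \<subseteq> {w \<in> I. 0 < \<psi> w x}}"

definition nerve_map :: "nat set \<Rightarrow> (nat \<Rightarrow> 'a \<Rightarrow> real) \<Rightarrow> 'a \<Rightarrow> (nat \<Rightarrow>\<^sub>0 real)" where
  "nerve_map I \<psi> x = (\<Sum>w\<in>I. \<psi> w x *\<^sub>R vert w)"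

lemma coord_nerve_map: "finite I \<Longrightarrow> coord (nerve_map I \<psi> x) v = (if v \<in> I then \<psi> v x else 0)"
proof -
  assume I: "finite I"
  have "coord (nerve_map I \<psi> x) v = (\<Sum>w\<in>I. if w = v then \<psi> w x else 0)"
    unfolding nerve_map_def coord_sum_scaleR by (rule sum.cong) (auto simp: lookup_single)
  then show ?thesis using I by simp
qed

lemma nerve_subset: "S \<in> nerve X I \<psi> \<Longrightarrow> S \<subseteq> I" by (auto simp: nerve_def)

lemma finite_nerve: "finite I \<Longrightarrow> finite (nerve X I \<psi>)"
  by (rule finite_subset[of _ "Pow I"]) (auto dest: nerve_subset)

lemma finite_complex_nerve: "finite I \<Longrightarrow> finite_complex (std_simplex ` nerve X I \<psi>)"
proof (rule finite_complex_std_simplices)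
  assume I: "finite I"
  show "finite (nerve X I \<psi>)" using I by (rule finite_nerve)
  show "finite S" if "S \<in> nerve X I \<psi>" for S using nerve_subset[OF that] I finite_subset by blast
  show "T \<in> nerve X I \<psi>" if "S \<in> nerve X I \<psi>" "T \<subseteq> S" for S T
    using that unfolding nerve_def by blast
qed

text \<open>The open stars of the vertices cover the polyhedron, and their preimages are the sets on which the
functions of the partition of unity are positive.\<close>

lemma cover_map_nerve_map:
  assumes I: "finite I" and cont: "\<And>w. w \<in> I \<Longrightarrow> continuous_map X euclideanreal (\<psi> w)"
    and nonneg: "\<And>w x. w \<in> I \<Longrightarrow> x \<in> topspace X \<Longrightarrow> 0 \<le> \<psi> w x"
    and sum: "\<And>x. x \<in> topspace X \<Longrightarrow> (\<Sum>w\<in>I. \<psi> w x) = 1"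
    and sub: "\<And>w. w \<in> I \<Longrightarrow> \<exists>W\<in>\<omega>. {x \<in> topspace X. 0 < \<psi> w x} \<subseteq> W"
  shows "cover_map \<omega> X (polyhedron_of (std_simplex ` nerve X I \<psi>)) (nerve_map I \<psi>)"
proof -
  let ?P = "\<Union>(std_simplex ` nerve X I \<psi>)"
  have inP: "nerve_map I \<psi> x \<in> ?P" if x: "x \<in> topspace X" for x
  proof -
    let ?S = "{w \<in> I. 0 < \<psi> w x}"
    have pos: "\<psi> w x = 0" if "w \<in> I" "\<not> 0 < \<psi> w x" for w using nonneg[OF that(1) x] that by force
    have "nerve_map I \<psi> x \<in> std_simplex ?S"
      unfolding std_simplex_def
    proof (intro CollectI conjI allI)
      show "supp (nerve_map I \<psi> x) \<subseteq> ?S"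
        using pos by (force simp: in_keys_iff coord_nerve_map[OF I] split: if_splits)
      show "0 \<le> coord (nerve_map I \<psi> x) w" for w using nonneg x by (simp add: coord_nerve_map[OF I])
      have "(\<Sum>w\<in>?S. coord (nerve_map I \<psi> x) w) = (\<Sum>w\<in>?S. \<psi> w x)"
        by (rule sum.cong) (auto simp: coord_nerve_map[OF I])
      also have "\<dots> = (\<Sum>w\<in>I. \<psi> w x)" using I pos by (intro sum.mono_neutral_left) auto
      finally show "(\<Sum>w\<in>?S. coord (nerve_map I \<psi> x) w) = 1" using sum[OF x] by simp
    qed
    moreover have "?S \<in> nerve X I \<psi>" using x by (auto simp: nerve_def)
    ultimately show ?thesis by blast
  qed
  have "continuous_map X euclidean (nerve_map I \<psi>)"
    unfolding nerve_map_def
  proof (rule continuous_map_sum[OF I])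
    fix w assume "w \<in> I"
    have "continuous_map euclideanreal euclidean (\<lambda>t. t *\<^sub>R vert w)"
      by (simp add: continuous_intros)
    from continuous_map_compose[OF cont[OF \<open>w \<in> I\<close>] this]
    show "continuous_map X euclidean (\<lambda>x. \<psi> w x *\<^sub>R vert w)" by (simp add: comp_def)
  qed
  then have c: "continuous_map X (top_of_set ?P) (nerve_map I \<psi>)"
    using inP by (auto simp: continuous_map_in_subtopology)
  define V where "V w = ?P \<inter> {z. 0 < coord z w}" for w
  have "openin (top_of_set ?P) (V w)" for w
  proof -
    have "open {z. 0 < coord z w}"
      by (intro open_Collect_less continuous_on_const linear_continuous_on bounded_linear_coord)
    then show ?thesis unfolding V_def by blast
  qed
  moreover have "?P \<subseteq> \<Union>(V ` I)"
  proof
    fix z assume z: "z \<in> ?P"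
    then obtain S where S: "S \<in> nerve X I \<psi>" "z \<in> std_simplex S" by blast
    have "\<exists>w\<in>S. 0 < coord z w"
    proof (rule ccontr)
      assume "\<not> (\<exists>w\<in>S. 0 < coord z w)"
      then have "(\<Sum>w\<in>S. coord z w) \<le> 0" by (intro sum_nonpos) (auto simp: not_less)
      then show False using S(2) by (simp add: std_simplex_def)
    qed
    then show "z \<in> \<Union>(V ` I)" using nerve_subset[OF S(1)] z unfolding V_def by blast
  qed
  moreover have "\<Union>(V ` I) \<subseteq> ?P" by (auto simp: V_def)
  ultimately have "open_cover (top_of_set ?P) (V ` I)"
    unfolding open_cover_def by auto
  moreover have "\<exists>W\<in>\<omega>. {x \<in> topspace X. nerve_map I \<psi> x \<in> U} \<subseteq> W" if U: "U \<in> V ` I" for U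
  proof -
    obtain w where w: "w \<in> I" "U = V w" using U by blast
    have "{x \<in> topspace X. nerve_map I \<psi> x \<in> U} \<subseteq> {x \<in> topspace X. 0 < \<psi> w x}"
      using w by (auto simp: V_def coord_nerve_map[OF I])
    then show ?thesis using sub[OF w(1)] by (meson order_trans)
  qed
  ultimately show ?thesis unfolding cover_map_def polyhedron_of_def using c by blast
qed

text \<open>Since \<open>\<phi> v \<circ> f\<close> is the sum of the functions over \<open>v\<close>, the barycentric coordinates of the two nerve
maps are compatible with the map of vertices \<open>\<pi>\<close>.\<close>

lemma simplicial_approximation_of_partitions:
  fixes \<phi> :: "nat \<Rightarrow> 'b \<Rightarrow> real" and \<psi> :: "nat \<Rightarrow> 'a \<Rightarrow> real"
  assumes f: "\<And>x. x \<in> topspace X \<Longrightarrow> f x \<in> topspace Y"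
    and I: "finite I" and J: "finite J" "\<pi> ` I \<subseteq> J"
    and \<phi>: "\<And>v. v \<in> J \<Longrightarrow> continuous_map Y euclideanreal (\<phi> v)" "\<And>v y. v \<in> J \<Longrightarrow> y \<in> topspace Y \<Longrightarrow> 0 \<le> \<phi> v y"
      "\<And>y. y \<in> topspace Y \<Longrightarrow> (\<Sum>v\<in>J. \<phi> v y) = 1"
      "\<And>v. v \<in> J \<Longrightarrow> \<exists>W\<in>\<omega>Y. {y \<in> topspace Y. 0 < \<phi> v y} \<subseteq> W"
    and \<psi>: "\<And>w. w \<in> I \<Longrightarrow> continuous_map X euclideanreal (\<psi> w)" "\<And>w x. w \<in> I \<Longrightarrow> x \<in> topspace X \<Longrightarrow> 0 \<le> \<psi> w x"
      "\<And>w. w \<in> I \<Longrightarrow> \<exists>W\<in>\<omega>X. {x \<in> topspace X. 0 < \<psi> w x} \<subseteq> W"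
    and split: "\<And>v x. v \<in> J \<Longrightarrow> x \<in> topspace X \<Longrightarrow> (\<Sum>w\<in>{w \<in> I. \<pi> w = v}. \<psi> w x) = \<phi> v (f x)"
    and card: "\<And>S. S \<in> nerve X I \<psi> \<Longrightarrow> card S \<le> k + card (\<pi> ` S)"
  defines "K \<equiv> std_simplex ` nerve X I \<psi>" and "L \<equiv> std_simplex ` nerve Y J \<phi>"
  shows "finite_complex K \<and> finite_complex L \<and>
    cover_map \<omega>X X (polyhedron_of K) (nerve_map I \<psi>) \<and> cover_map \<omega>Y Y (polyhedron_of L) (nerve_map J \<phi>) \<and>
    simplicial_map_on K L (vertex_map \<pi> I) \<and>
    dimensional_map k (polyhedron_of K) (polyhedron_of L) (vertex_map \<pi> I) \<and>
    (\<forall>x\<in>topspace X. vertex_map \<pi> I (nerve_map I \<psi> x) = nerve_map J \<phi> (f x))" (is "_ \<and> _ \<and> ?X \<and> ?Y \<and> _ \<and> _ \<and> _")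
    "\<And>S. S \<in> nerve X I \<psi> \<Longrightarrow> \<pi> ` S \<in> nerve Y J \<phi>"
proof -
  show im: "\<pi> ` S \<in> nerve Y J \<phi>" if S: "S \<in> nerve X I \<psi>" for S
  proof -
    obtain x where x: "x \<in> topspace X" "S \<subseteq> {w \<in> I. 0 < \<psi> w x}" using S by (auto simp: nerve_def)
    have "\<pi> w \<in> {v \<in> J. 0 < \<phi> v (f x)}" if w: "w \<in> S" for w
    proof -
      have wI: "w \<in> I" "0 < \<psi> w x" "\<pi> w \<in> J" using w x(2) J(2) by auto
      have "\<psi> w x \<le> (\<Sum>u\<in>{u \<in> I. \<pi> u = \<pi> w}. \<psi> u x)"
        by (rule member_le_sum) (use wI I \<psi>(2) x in auto)
      then show ?thesis using split[OF wI(3) x(1)] wI by auto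
    qed
    then show ?thesis using f[OF x(1)] unfolding nerve_def by blast
  qed
  have sub: "S \<subseteq> I" if "S \<in> nerve X I \<psi>" for S using that by (rule nerve_subset)
  have X: ?X unfolding K_def
  proof (rule cover_map_nerve_map[OF I])
    show "(\<Sum>w\<in>I. \<psi> w x) = 1" if x: "x \<in> topspace X" for x
    proof -
      have "(\<Sum>w\<in>I. \<psi> w x) = (\<Sum>v\<in>J. \<Sum>w\<in>{w \<in> I. \<pi> w = v}. \<psi> w x)"
        using sum.group[OF I J, of "\<lambda>w. \<psi> w x"] by simp
      also have "\<dots> = (\<Sum>v\<in>J. \<phi> v (f x))" using split x by simp
      finally show ?thesis using \<phi>(3)[OF f[OF x]] by simp
    qed
  qed (use \<psi> in auto)
  have Y: ?Y unfolding L_def by (rule cover_map_nerve_map[OF J(1)]) (use \<phi> in auto)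
  have "vertex_map \<pi> I (nerve_map I \<psi> x) = nerve_map J \<phi> (f x)" if x: "x \<in> topspace X" for x
  proof (rule poly_mapping_eqI)
    fix v
    have "coord (vertex_map \<pi> I (nerve_map I \<psi> x)) v = (\<Sum>w\<in>{w \<in> I. \<pi> w = v}. \<psi> w x)"
      unfolding coord_vertex_map[OF I] by (rule sum.cong) (auto simp: coord_nerve_map[OF I])
    also have "\<dots> = (if v \<in> J then \<phi> v (f x) else 0)"
    proof (cases "v \<in> J")
      case False
      then have "{w \<in> I. \<pi> w = v} = {}" using J(2) by auto
      then show ?thesis using False by (simp only: sum.empty if_False)
    qed (simp add: split x)
    finally show "coord (vertex_map \<pi> I (nerve_map I \<psi> x)) v = coord (nerve_map J \<phi> (f x)) v"
      by (simp add: coord_nerve_map[OF J(1)])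
  qed
  moreover have "simplicial_map_on K L (vertex_map \<pi> I)"
    unfolding K_def L_def using I sub im by (rule simplicial_vertex_map)
  moreover have "dimensional_map k (polyhedron_of K) (polyhedron_of L) (vertex_map \<pi> I)"
    unfolding K_def L_def using I finite_nerve[OF I] sub card im by (rule dimensional_vertex_map)
  ultimately show "finite_complex K \<and> finite_complex L \<and>
    cover_map \<omega>X X (polyhedron_of K) (nerve_map I \<psi>) \<and> cover_map \<omega>Y Y (polyhedron_of L) (nerve_map J \<phi>) \<and>
    simplicial_map_on K L (vertex_map \<pi> I) \<and>
    dimensional_map k (polyhedron_of K) (polyhedron_of L) (vertex_map \<pi> I) \<and>
    (\<forall>x\<in>topspace X. vertex_map \<pi> I (nerve_map I \<psi> x) = nerve_map J \<phi> (f x))"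
    using X Y finite_complex_nerve[OF I] finite_complex_nerve[OF J(1)] unfolding K_def L_def by blast
qed

section \<open>Refining a partition of unity by a second one\<close>

text \<open>Counting the smaller elements in both coordinates is strictly monotone along a chain and takes
values from 0 to the sum of the cardinalities of the projections minus 2.\<close>

lemma card_chain_le:
  fixes P :: "(nat \<times> nat) set"
  assumes fin: "finite P" "P \<noteq> {}"
    and chain: "\<And>p q. \<lbrakk>p \<in> P; q \<in> P; fst p < fst q\<rbrakk> \<Longrightarrow> snd p \<le> snd q"
  shows "card P + 1 \<le> card (fst ` P) + card (snd ` P)"
proof -
  define r where "r p = card {a \<in> fst ` P. a < fst p} + card {b \<in> snd ` P. b < snd p}" for p
  have mono: "card {a \<in> A. a < s} \<le> card {a \<in> A. a < t}" if "s \<le> t" "finite A" for A and s t :: nat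
    using that by (intro card_mono) auto
  have strict: "card {a \<in> A. a < s} < card {a \<in> A. a < t}" if "s < t" "s \<in> A" "finite A" for A and s t :: nat
    using that by (intro psubset_card_mono) auto
  have "r p \<noteq> r q" if "p \<in> P" "q \<in> P" "p \<noteq> q" for p q
  proof -
    have less: "r p < r q" if "p \<in> P" "q \<in> P" "fst p < fst q" for p q
      using strict[of "fst p" "fst q" "fst ` P"] mono[of "snd p" "snd q" "snd ` P"] chain that fin
      unfolding r_def by (intro add_less_le_mono) auto
    have less': "r p < r q" if "p \<in> P" "q \<in> P" "fst p = fst q" "snd p < snd q" for p q
      using strict[of "snd p" "snd q" "snd ` P"] that fin unfolding r_def by auto
    consider "fst p < fst q" | "fst q < fst p" | "fst p = fst q" "snd p < snd q" | "fst p = fst q" "snd q < snd p"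
      using \<open>p \<noteq> q\<close> by (metis linorder_neqE_nat prod_eq_iff)
    then show ?thesis using less[of p q] less[of q p] less'[of p q] less'[of q p] that by cases auto
  qed
  then have "inj_on r P" by (auto simp: inj_on_def)
  moreover have "r ` P \<subseteq> {..<card (fst ` P) + card (snd ` P) - 1}"
  proof
    fix n assume "n \<in> r ` P"
    then obtain p where p: "p \<in> P" "n = r p" by blast
    have "card {a \<in> fst ` P. a < fst p} < card (fst ` P)" "card {b \<in> snd ` P. b < snd p} < card (snd ` P)"
      using p fin by (auto intro!: psubset_card_mono)
    then show "n \<in> {..<card (fst ` P) + card (snd ` P) - 1}" using p(2) unfolding r_def by simp
  qed
  ultimately have "card P \<le> card (fst ` P) + card (snd ` P) - 1"
    using card_inj_on_le[of r P "{..<card (fst ` P) + card (snd ` P) - 1}"] by simp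
  moreover have "card (fst ` P) > 0" using fin by (simp add: card_gt_0_iff)
  ultimately show ?thesis by linarith
qed

text \<open>If the half-line is divided into consecutive intervals of lengths \<open>a 0, a 1, \<dots>\<close>, and again into
consecutive intervals of lengths \<open>b 0, b 1, \<dots>\<close>, this is the length of the intersection of the
\<open>v\<close>-th interval of the first kind and the \<open>i\<close>-th one of the second kind.\<close>

definition overlap :: "(nat \<Rightarrow> real) \<Rightarrow> (nat \<Rightarrow> real) \<Rightarrow> nat \<Rightarrow> nat \<Rightarrow> real" where
  "overlap a b v i = max 0 (min (sum a {..v}) (sum b {..i}) - max (sum a {..<v}) (sum b {..<i}))"

lemma overlap_nonneg: "0 \<le> overlap a b v i"
  by (simp add: overlap_def)

lemma overlap_pos:
  assumes "0 < overlap a b v i" shows "0 < a v" "0 < b i"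
  using assms by (auto simp: overlap_def max_def min_def lessThan_Suc_atMost[symmetric] split: if_splits)

text \<open>The intervals of the second kind cover the \<open>v\<close>-th one of the first kind. In formulas: clamping the
partial sums of \<open>b\<close> to that interval turns the sum into a telescoping one.\<close>

lemma sum_overlap:
  assumes a: "\<And>v. 0 \<le> a v" and b: "\<And>i. 0 \<le> b i" and v: "sum a {..v} \<le> 1" and 1: "sum b {..<n} = 1"
  shows "(\<Sum>i<n. overlap a b v i) = a v"
proof -
  define s t where "s = sum a {..<v}" and "t = sum a {..v}"
  \<comment> \<open>the left end point of the \<open>i\<close>-th interval of the second kind, clamped to the interval from \<open>s\<close> to \<open>t\<close>\<close>
  define c where "c i = min t (max s (sum b {..<i}))" for i
  have st: "0 \<le> s" "t = s + a v" "t \<le> 1"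
    using a v by (auto simp: s_def t_def sum_nonneg lessThan_Suc_atMost[symmetric])
  have "overlap a b v i = c (Suc i) - c i" for i
    using st a[of v] b[of i]
    by (auto simp: overlap_def c_def s_def[symmetric] t_def[symmetric] lessThan_Suc_atMost[symmetric] max_def min_def)
  then have "(\<Sum>i<n. overlap a b v i) = c n - c 0" by (simp add: sum_lessThan_telescope)
  also have "\<dots> = a v" using st 1 a[of v] by (auto simp: c_def)
  finally show ?thesis .
qed

text \<open>A positive overlap of \<open>v\<close> with \<open>i\<close> means that the two intervals have interior points in
common. If \<open>v < v'\<close>, those for \<open>(v, i)\<close> lie to the left of those for \<open>(v', i')\<close>.\<close>

lemma overlap_chain:
  assumes a: "\<And>v. 0 \<le> a v" and b: "\<And>i. 0 \<le> b i"
    and pos: "0 < overlap a b v i" "0 < overlap a b v' i'" and v: "v < v'"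
  shows "i \<le> i'"
proof (rule ccontr)
  assume "\<not> i \<le> i'"
  then have "sum b {..i'} \<le> sum b {..<i}" "sum a {..v} \<le> sum a {..<v'}"
    using a b v by (auto intro!: sum_mono2)
  then show False using pos by (auto simp: overlap_def max_def min_def split: if_splits)
qed

lemma card_overlap_le:
  assumes a: "\<And>v. 0 \<le> a v" and b: "\<And>i. 0 \<le> b i" and P: "finite P" "snd ` P \<subseteq> {..k}"
    and pos: "\<And>v i. (v, i) \<in> P \<Longrightarrow> 0 < overlap a b v i"
  shows "card P \<le> k + card (fst ` P)"
proof (cases "P = {}")
  case False
  have "snd p \<le> snd q" if "p \<in> P" "q \<in> P" "fst p < fst q" for p q
    using overlap_chain[of a b "fst p" "snd p" "fst q" "snd q"] a b pos that by auto
  then have "card P + 1 \<le> card (fst ` P) + card (snd ` P)" using card_chain_le P False by blast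
  moreover have "card (snd ` P) \<le> k + 1" using card_mono[OF _ P(2)] by simp
  ultimately show ?thesis by linarith
qed simp

lemma continuous_map_overlap:
  assumes "\<And>v. v < m \<Longrightarrow> continuous_map X euclideanreal (a v)" "\<And>i. i < n \<Longrightarrow> continuous_map X euclideanreal (b i)"
    and "v < m" "i < n"
  shows "continuous_map X euclideanreal (\<lambda>x. overlap (\<lambda>v. a v x) (\<lambda>i. b i x) v i)"
  unfolding overlap_def
  by (intro continuous_map_real_max continuous_map_real_min continuous_map_diff continuous_map_sum) (use assms in auto)

text \<open>Restricting \<open>g\<close> to one colour class and extending it by 0 is continuous: inside \<open>S\<close> the class is
both open and closed, and outside \<open>S\<close> the function \<open>g\<close> itself vanishes.\<close>

lemma (in Metric_space) continuous_map_color_part: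
  assumes S: "openin mtopology S" and r: "0 < r"
    and c: "\<And>x y. \<lbrakk>x \<in> S; y \<in> S; d x y < r\<rbrakk> \<Longrightarrow> c x = c y"
    and g: "continuous_map mtopology euclideanreal g" "\<And>x. x \<in> M \<Longrightarrow> 0 \<le> g x" "\<And>x. x \<in> M \<Longrightarrow> 0 < g x \<Longrightarrow> x \<in> S"
  shows "continuous_map mtopology euclideanreal (\<lambda>x. if x \<in> S \<and> c x = j then g x else 0)" (is "continuous_map _ _ ?h")
proof -
  have up: "openin mtopology {x \<in> M. g x > t}" and down: "openin mtopology {x \<in> M. g x < t}" for t
    using g(1) unfolding continuous_map_upper_lower_semicontinuous_lt by simp_all
  have col: "openin mtopology {x \<in> S. P (c x)}" for P
    by (rule openin_color_class[OF S r, where c=c and P=P]) (rule c)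
  have SM: "S \<subseteq> M" using openin_subset[OF S] by simp
  have "openin mtopology {x \<in> M. ?h x > t}" for t
  proof (cases "t < 0")
    case True
    then have "{x \<in> M. ?h x > t} = M" using g(2) by force
    then show ?thesis by (simp only: open_in_mspace)
  next
    case False
    then have "{x \<in> M. ?h x > t} = {x \<in> M. g x > t} \<inter> {x \<in> S. c x = j}" using SM by auto
    then show ?thesis using openin_Int[OF up col[of "\<lambda>i. i = j"]] by (simp only:)
  qed
  moreover have "openin mtopology {x \<in> M. ?h x < t}" for t
  proof (cases "t \<le> 0")
    case True
    then have "{x \<in> M. ?h x < t} = {}" using g(2) by force
    then show ?thesis by (simp only: openin_empty)
  next
    case False
    have "{x \<in> M. ?h x < t} = {x \<in> M. g x < t} \<union> {x \<in> S. c x \<noteq> j}"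
    proof (intro equalityI subsetI)
      fix x assume x: "x \<in> {x \<in> M. ?h x < t}"
      show "x \<in> {x \<in> M. g x < t} \<union> {x \<in> S. c x \<noteq> j}"
      proof (cases "x \<in> S")
        case False
        then have "g x = 0" using g(2,3) x by force
        then show ?thesis using x \<open>\<not> t \<le> 0\<close> by simp
      qed (use x in \<open>auto split: if_splits\<close>)
    qed (use SM False in auto)
    then show ?thesis using openin_Un[OF down col[of "\<lambda>i. i \<noteq> j"]] by (simp only:)
  qed
  ultimately show ?thesis unfolding continuous_map_upper_lower_semicontinuous_lt by simp
qed

text \<open>Restrict \<open>g\<close> to the finitely many chain classes of \<open>S\<close>.\<close>

lemma (in Metric_space) split_bump_function:
  assumes cpt: "compact_space mtopology" and S: "openin mtopology S" and r: "0 < r"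
    and fine: "chain_fine d r e S"
    and g: "continuous_map mtopology euclideanreal g" "\<And>x. x \<in> M \<Longrightarrow> 0 \<le> g x" "\<And>x. x \<in> M \<Longrightarrow> 0 < g x \<Longrightarrow> x \<in> S"
  obtains J :: nat and h where "\<And>j. continuous_map mtopology euclideanreal (h j)" "\<And>j x. x \<in> M \<Longrightarrow> 0 \<le> h j x"
    "\<And>x. x \<in> M \<Longrightarrow> (\<Sum>j<J. h j x) = g x" "\<And>j x. 0 < h j x \<Longrightarrow> 0 < g x"
    "\<And>i j x. 0 < h i x \<Longrightarrow> 0 < h j x \<Longrightarrow> i = j"
    "\<And>j x y. \<lbrakk>0 < h j x; 0 < h j y\<rbrakk> \<Longrightarrow> d x y \<le> e" "0 < J \<Longrightarrow> M \<noteq> {}"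
proof -
  have SM: "S \<subseteq> M" using openin_subset[OF S] by simp
  obtain c and J :: nat where c: "\<And>x. x \<in> S \<Longrightarrow> c x < J"
    "\<And>x y. \<lbrakk>x \<in> S; y \<in> S; d x y < r\<rbrakk> \<Longrightarrow> c x = c y" "\<And>x y. \<lbrakk>x \<in> S; y \<in> S; c x = c y\<rbrakk> \<Longrightarrow> d x y \<le> e"
    by (rule finite_chain_coloring[OF cpt SM r fine]) blast
  define h where "h j x = (if x \<in> S \<and> c x = j then g x else 0)" for j x
  \<comment> \<open>an empty space gets no pieces, since an open cover of it may have no members\<close>
  define J' where "J' = (if M = {} then 0 else J)"
  have h_pos: "x \<in> S" "c x = j" "0 < g x" if "0 < h j x" for j x
    using that by (simp_all add: h_def split: if_splits)
  show thesis
  proof (rule that[of h J'])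
    show "continuous_map mtopology euclideanreal (h j)" for j
      unfolding h_def by (rule continuous_map_color_part[OF S r c(2) g])
    show "(\<Sum>j<J'. h j x) = g x" if x: "x \<in> M" for x
    proof (cases "x \<in> S")
      case True
      have "(\<Sum>j<J'. h j x) = (\<Sum>j<J. if c x = j then g x else 0)"
        using x True by (auto simp: J'_def h_def intro!: sum.cong)
      then show ?thesis using c(1)[OF True] by simp
    next
      case False
      then have "g x = 0" using g(2,3) x by force
      then show ?thesis using False by (simp add: h_def)
    qed
    show "0 \<le> h j x" if "x \<in> M" for j x using g(2)[OF that] by (simp add: h_def)
    show "d x y \<le> e" if "0 < h j x" "0 < h j y" for j x y
      using c(3)[of x y] h_pos[OF that(1)] h_pos[OF that(2)] by simp
    show "0 < g x" if "0 < h j x" for j x using h_pos(3)[OF that] .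
    show "i = j" if "0 < h i x" "0 < h j x" for i j x
      using h_pos(2)[OF that(1)] h_pos(2)[OF that(2)] by simp
    show "M \<noteq> {}" if "0 < J'"
    proof
      assume "M = {}"
      then show False using that by (simp add: J'_def)
    qed
  qed
qed

text \<open>The index \<open>w\<close> encodes a triple \<open>(v, i, j)\<close>: the \<open>j\<close>-th piece of the overlap of \<open>a v\<close> with the \<open>i\<close>-th
function of a partition of unity subordinate to \<open>G\<close>. At a given point, \<open>(v, i)\<close> determines \<open>j\<close>, so
the cardinality estimate is that for overlaps.\<close>

lemma (in Metric_space) refined_partition_of_unity:
  assumes cpt: "compact_space mtopology" and r: "0 < r"
    and A: "\<And>v. v < m \<Longrightarrow> openin mtopology (A v)"
    and a: "\<And>v. v < m \<Longrightarrow> continuous_map mtopology euclideanreal (a v)" "\<And>v x. 0 \<le> a v x"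
      "\<And>x. x \<in> M \<Longrightarrow> (\<Sum>v<m. a v x) = 1" "\<And>v x. \<lbrakk>v < m; x \<in> M; 0 < a v x\<rbrakk> \<Longrightarrow> x \<in> A v"
    and G: "\<And>i. i \<le> k \<Longrightarrow> openin mtopology (G i)" "M \<subseteq> (\<Union>i\<le>k. G i)"
    and fine: "\<And>v i. \<lbrakk>v < m; i \<le> k\<rbrakk> \<Longrightarrow> chain_fine d r e (A v \<inter> G i)"
  obtains I :: "nat set" and \<pi> :: "nat \<Rightarrow> nat" and \<psi> where "finite I" "\<pi> ` I \<subseteq> {..<m}"
    "\<And>w. w \<in> I \<Longrightarrow> continuous_map mtopology euclideanreal (\<psi> w)"
    "\<And>w x. \<lbrakk>w \<in> I; x \<in> M\<rbrakk> \<Longrightarrow> 0 \<le> \<psi> w x"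
    "\<And>v x. \<lbrakk>v < m; x \<in> M\<rbrakk> \<Longrightarrow> (\<Sum>w\<in>{w \<in> I. \<pi> w = v}. \<psi> w x) = a v x"
    "\<And>w x y. \<lbrakk>w \<in> I; 0 < \<psi> w x; 0 < \<psi> w y\<rbrakk> \<Longrightarrow> d x y \<le> e" "\<And>w. w \<in> I \<Longrightarrow> M \<noteq> {}"
    "\<And>x S. \<lbrakk>x \<in> M; S \<subseteq> {w \<in> I. 0 < \<psi> w x}\<rbrakk> \<Longrightarrow> card S \<le> k + card (\<pi> ` S)"
proof -
  have G1: "openin mtopology (G i)" if "i \<in> {..<Suc k}" for i using that G(1)[of i] by simp
  have G2: "M \<subseteq> (\<Union>i\<in>{..<Suc k}. G i)" using G(2) by (simp only: lessThan_Suc_atMost)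
  obtain b where b: "\<And>i. i \<in> {..<Suc k} \<Longrightarrow> continuous_map mtopology euclideanreal (b i)"
    "\<And>i x. 0 \<le> b i x" "\<And>x. x \<in> M \<Longrightarrow> (\<Sum>i<Suc k. b i x) = 1"
    "\<And>i x. \<lbrakk>i \<in> {..<Suc k}; x \<in> M; 0 < b i x\<rbrakk> \<Longrightarrow> x \<in> G i"
    using partition_of_unity[OF finite_lessThan G1 G2] by blast
  define g where "g v i x = overlap (\<lambda>v. a v x) (\<lambda>i. b i x) v i" for v i x
  define pieces where "pieces v i J h \<longleftrightarrow> (\<forall>j::nat. continuous_map mtopology euclideanreal (h j)) \<and> (\<forall>j. \<forall>x\<in>M. 0 \<le> h j x) \<and>
     (\<forall>x\<in>M. (\<Sum>j<J. h j x) = g v i x) \<and> (\<forall>j x. 0 < h j x \<longrightarrow> 0 < g v i x) \<and>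
     (\<forall>j j' x. 0 < h j x \<longrightarrow> 0 < h j' x \<longrightarrow> j = j') \<and>
     (\<forall>j x y. 0 < h j x \<longrightarrow> 0 < h j y \<longrightarrow> d x y \<le> e) \<and> (0 < J \<longrightarrow> M \<noteq> {})" for v i J h
  have "\<exists>J h. pieces v i J h" if v: "v < m" and i: "i \<le> k" for v i
  proof -
    have S: "openin mtopology (A v \<inter> G i)" using A[OF v] G(1)[OF i] by (rule openin_Int)
    have cont: "continuous_map mtopology euclideanreal (g v i)"
      unfolding g_def by (rule continuous_map_overlap[where m=m and n="Suc k"]) (use a(1) b(1) v i in auto)
    have nonneg: "0 \<le> g v i x" if "x \<in> M" for x by (simp add: g_def overlap_nonneg)
    have supp: "x \<in> A v \<inter> G i" if x: "x \<in> M" "0 < g v i x" for x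
    proof
      show "x \<in> A v" using a(4)[OF v x(1)] overlap_pos(1)[OF x(2)[unfolded g_def]] by simp
      show "x \<in> G i" using b(4)[of i x] i x(1) overlap_pos(2)[OF x(2)[unfolded g_def]] by simp
    qed
    show ?thesis
    proof (rule split_bump_function[OF cpt S r fine[OF v i] cont nonneg supp])
      fix h and J :: nat
      assume h: "\<And>j. continuous_map mtopology euclideanreal (h j)" "\<And>j x. x \<in> M \<Longrightarrow> 0 \<le> h j x"
        "\<And>x. x \<in> M \<Longrightarrow> (\<Sum>j<J. h j x) = g v i x" "\<And>j x. 0 < h j x \<Longrightarrow> 0 < g v i x"
        "\<And>i j x. 0 < h i x \<Longrightarrow> 0 < h j x \<Longrightarrow> i = j"
        "\<And>j x y. \<lbrakk>0 < h j x; 0 < h j y\<rbrakk> \<Longrightarrow> d x y \<le> e" "0 < J \<Longrightarrow> M \<noteq> {}"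
      have "pieces v i J h"
        unfolding pieces_def by (intro conjI allI ballI impI; rule h; assumption)
      then show ?thesis by blast
    qed
  qed
  then obtain J h where pieces: "\<And>v i. v < m \<Longrightarrow> i \<le> k \<Longrightarrow> pieces v i (J v i) (h v i)" by metis
  define D where "D v = (SIGMA i:{..<Suc k}. {..<J v i})" for v
  define I where "I = to_nat ` (SIGMA v:{..<m}. D v)"
  define \<pi> where "\<pi> w = fst (from_nat w :: nat \<times> nat \<times> nat)" for w
  define \<psi> where "\<psi> w = (case from_nat w of (v, i, j) \<Rightarrow> h v i j)" for w
  have enc: "\<pi> (to_nat (v, i, j)) = v" "\<psi> (to_nat (v, i, j)) = h v i j" for v i j :: nat
    by (simp_all add: \<pi>_def \<psi>_def)
  have I_E: "\<exists>v i j. w = to_nat (v, i, j) \<and> v < m \<and> i \<le> k \<and> j < J v i \<and> \<pi> w = v \<and> \<psi> w = h v i j \<and>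
      pieces v i (J v i) (h v i)" if w: "w \<in> I" for w
  proof -
    obtain v i j where "v < m" "i < Suc k" "j < J v i" "w = to_nat (v, i, j)"
      using w unfolding I_def D_def by auto
    then show ?thesis using enc pieces by (intro exI[of _ v] exI[of _ i] exI[of _ j]) auto
  qed
  show thesis
  proof (rule that[of I \<pi> \<psi>])
    show finI: "finite I" by (auto simp: I_def D_def)
    show "\<pi> ` I \<subseteq> {..<m}" using I_E by fastforce
    show "continuous_map mtopology euclideanreal (\<psi> w)" if "w \<in> I" for w
      using I_E[OF that] by (auto simp: pieces_def)
    show "0 \<le> \<psi> w x" if "w \<in> I" "x \<in> M" for w x
      using I_E[OF that(1)] that(2) by (auto simp: pieces_def)
    show "d x y \<le> e" if "w \<in> I" "0 < \<psi> w x" "0 < \<psi> w y" for w x y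
      using I_E[OF that(1)] that(2,3) unfolding pieces_def by metis
    show "M \<noteq> {}" if w: "w \<in> I" for w
    proof -
      obtain v i j where "j < J v i" "pieces v i (J v i) (h v i)" using I_E[OF w] by blast
      then show ?thesis unfolding pieces_def by (metis gr_zeroI not_less_zero)
    qed
    show "(\<Sum>w\<in>{w \<in> I. \<pi> w = v}. \<psi> w x) = a v x" if v: "v < m" and x: "x \<in> M" for v x
    proof -
      have "{w \<in> I. \<pi> w = v} = (\<lambda>q. to_nat (v, q)) ` D v"
        using v by (auto simp: I_def \<pi>_def)
      then have "(\<Sum>w\<in>{w \<in> I. \<pi> w = v}. \<psi> w x) = (\<Sum>q\<in>D v. \<psi> (to_nat (v, q)) x)"
        by (simp add: sum.reindex inj_on_def)
      also have "\<dots> = (\<Sum>i<Suc k. \<Sum>j<J v i. h v i j x)"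
        unfolding D_def by (subst sum.Sigma) (auto simp: \<psi>_def intro!: sum.cong)
      also have "\<dots> = (\<Sum>i<Suc k. g v i x)"
        using pieces[OF v] x by (intro sum.cong) (auto simp: pieces_def less_Suc_eq_le)
      also have "\<dots> = a v x"
        unfolding g_def
      proof (rule sum_overlap)
        have "(\<Sum>u\<in>{..v}. a u x) \<le> (\<Sum>u<m. a u x)" using v a(2) by (intro sum_mono2) auto
        then show "(\<Sum>u\<in>{..v}. a u x) \<le> 1" using a(3)[OF x] by simp
      qed (use a(2) b(2,3) x in auto)
      finally show ?thesis .
    qed
    show "card S \<le> k + card (\<pi> ` S)" if x: "x \<in> M" and S: "S \<subseteq> {w \<in> I. 0 < \<psi> w x}" for x S
    proof -
      define q :: "nat \<Rightarrow> nat \<times> nat" where "q w = (case from_nat w of (v, i, j :: nat) \<Rightarrow> (v, i))" for w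
      have q: "q (to_nat (v, i, j)) = (v, i)" for v i j :: nat by (simp add: q_def)
      have "inj_on q S"
      proof (rule inj_onI)
        fix w w' assume w: "w \<in> S" "w' \<in> S" "q w = q w'"
        then have "w \<in> I" "w' \<in> I" "0 < \<psi> w x" "0 < \<psi> w' x" using S by auto
        then obtain v i j v' i' j' where 1: "w = to_nat (v, i, j)" "\<psi> w = h v i j" "pieces v i (J v i) (h v i)"
          and 2: "w' = to_nat (v', i', j')" "\<psi> w' = h v' i' j'" using I_E by meson
        have vi: "v' = v" "i' = i" using w(3) 1(1) 2(1) by (simp_all add: q)
        have "0 < h v i j x" "0 < h v i j' x" using \<open>0 < \<psi> w x\<close> \<open>0 < \<psi> w' x\<close> 1(2) 2(2) vi by simp_all
        then have "j = j'" using 1(3) unfolding pieces_def by blast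
        then show "w = w'" using 1(1) 2(1) vi by simp
      qed
      then have "card S = card (q ` S)" by (simp add: card_image)
      also have "\<dots> \<le> k + card (fst ` q ` S)"
      proof (rule card_overlap_le[where a="\<lambda>v. a v x" and b="\<lambda>i. b i x"])
        show "finite (q ` S)" using finite_subset[OF S] finI by simp
        have w: "\<exists>v i. q w = (v, i) \<and> i \<le> k \<and> 0 < g v i x" if w: "w \<in> S" for w
        proof -
          have "w \<in> I" "0 < \<psi> w x" using w S by auto
          then obtain v i j where 1: "w = to_nat (v, i, j)" "i \<le> k" "\<psi> w = h v i j" "pieces v i (J v i) (h v i)"
            using I_E by meson
          then have "0 < h v i j x" using \<open>0 < \<psi> w x\<close> by simp
          then have "0 < g v i x" using 1(4) unfolding pieces_def by blast
          then show ?thesis using 1(1,2) q by blast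
        qed
        show "snd ` q ` S \<subseteq> {..k}"
        proof
          fix i assume "i \<in> snd ` q ` S"
          then obtain w' where "w' \<in> S" "i = snd (q w')" by blast
          then show "i \<in> {..k}" using w[of w'] by auto
        qed
        show "0 < overlap (\<lambda>v. a v x) (\<lambda>i. b i x) v i" if vi: "(v, i) \<in> q ` S" for v i
        proof -
          obtain w' where "w' \<in> S" "(v, i) = q w'" using vi by (rule imageE) blast
          then show ?thesis using w[of w'] by (auto simp: g_def)
        qed
      qed (use a(2) b(2) in auto)
      also have "fst ` q ` S = \<pi> ` S"
        unfolding image_image by (rule image_cong) (auto simp: q_def \<pi>_def split: prod.splits)
      finally show ?thesis .
    qed
  qed
qed

section \<open>The factorization\<close>

lemma cover_map_empty_polyhedron:
  fixes \<kappa> :: "'a \<Rightarrow> 'v::real_normed_vector"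
  assumes "topspace X = {}" shows "cover_map \<omega> X (polyhedron_of {}) \<kappa>"
proof -
  have "polyhedron_of ({} :: 'v set set) = trivial_topology" by (simp add: polyhedron_of_def)
  moreover have "X = trivial_topology" using assms by simp
  moreover have "open_cover (trivial_topology :: 'v topology) {}" by (simp add: open_cover_def)
  ultimately show ?thesis unfolding cover_map_def by (intro conjI exI[of _ "{}"]) simp_all
qed

text \<open>Over an empty space the bounds on the dimensions leave no room for vertices, so that the empty
complex has to be taken.\<close>

lemma simplicial_factorization_over_empty:
  fixes f :: "'a \<Rightarrow> 'b"
  assumes X: "topspace X = {}" and Y: "topspace Y = {}"
  shows "\<exists>(K :: (nat \<Rightarrow>\<^sub>0 real) set set) (L :: (nat \<Rightarrow>\<^sub>0 real) set set) \<kappa>X \<kappa>Y p.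
           finite_complex K \<and> finite_complex L \<and>
           cover_map \<omega>X X (polyhedron_of K) \<kappa>X \<and>
           cover_map \<omega>Y Y (polyhedron_of L) \<kappa>Y \<and>
           simplicial_map_on K L p \<and>
           dimensional_map k (polyhedron_of K) (polyhedron_of L) p \<and>
           (\<forall>x\<in>topspace X. p (\<kappa>X x) = \<kappa>Y (f x)) \<and>
           covering_dim (polyhedron_of L) \<le> covering_dim Y \<and>
           covering_dim (polyhedron_of K) \<le> covering_dim Y + ereal (real k)"
proof -
  let ?E = "{} :: (nat \<Rightarrow>\<^sub>0 real) set set"
  have top: "topspace (polyhedron_of ?E) = {}" by (simp add: polyhedron_of_def)
  have low: "ereal (-1) \<le> covering_dim Y"
    unfolding covering_dim_def by (rule Inf_greatest) auto
  have "finite {} \<and> open_cover (polyhedron_of ?E) {} \<and> cover_refines {} \<U>" for \<U>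
    using top by (simp add: open_cover_def cover_refines_def)
  then have "covering_dim_le (polyhedron_of ?E) (-1)"
    unfolding covering_dim_le_def top by blast
  then have E: "covering_dim (polyhedron_of ?E) \<le> ereal (-1)"
    unfolding covering_dim_def by (intro Inf_lower CollectI exI[of _ "-1"]) simp
  have low': "ereal (-1) \<le> covering_dim Y + ereal (real k)"
    using add_mono[OF low, of 0 "ereal (real k)"] by simp
  have "finite_complex ?E" "simplicial_map_on ?E ?E (\<lambda>_. 0)"
    by (simp_all add: finite_complex_def simplicial_map_on_def)
  moreover have "dimensional_map k (polyhedron_of ?E) (polyhedron_of ?E) (\<lambda>_. 0)"
    unfolding dimensional_map_def by (simp add: polyhedron_of_def)
  moreover have "\<forall>x\<in>topspace X. (\<lambda>_. 0 :: nat \<Rightarrow>\<^sub>0 real) (0 :: nat \<Rightarrow>\<^sub>0 real) = 0" by simp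
  ultimately show ?thesis
    using cover_map_empty_polyhedron[OF X] cover_map_empty_polyhedron[OF Y] order_trans[OF E low] order_trans[OF E low']
    by (intro exI[of _ ?E] exI[of _ "\<lambda>_. 0"] conjI) auto
qed

theorem theorem1p1:
  fixes X :: "'a topology" and Y :: "'b topology" and f :: "'a \<Rightarrow> 'b" and k :: nat
    and \<omega>X :: "'a set set" and \<omega>Y :: "'b set set"
  assumes "C_compactum X" and "C_compactum Y"
    and "dimensional_map k X Y f"
    and "open_cover X \<omega>X" and "open_cover Y \<omega>Y"
  shows "\<exists>(K :: (nat \<Rightarrow>\<^sub>0 real) set set) (L :: (nat \<Rightarrow>\<^sub>0 real) set set) \<kappa>X \<kappa>Y p.
           finite_complex K \<and> finite_complex L \<and>
           cover_map \<omega>X X (polyhedron_of K) \<kappa>X \<and>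
           cover_map \<omega>Y Y (polyhedron_of L) \<kappa>Y \<and>
           simplicial_map_on K L p \<and>
           dimensional_map k (polyhedron_of K) (polyhedron_of L) p \<and>
           (\<forall>x\<in>topspace X. p (\<kappa>X x) = \<kappa>Y (f x)) \<and>
           covering_dim (polyhedron_of L) \<le> covering_dim Y \<and>
           covering_dim (polyhedron_of K) \<le> covering_dim Y + ereal (real k)"
proof (cases "topspace Y = {}")
  case True
  have "continuous_map X Y f" using assms(3) by (simp add: dimensional_map_def)
  then have "topspace X = {}" using continuous_map_image_subset_topspace[of X Y f] True by blast
  then show ?thesis using True by (rule simplicial_factorization_over_empty)
next
  case False
  obtain M d where M: "Metric_space M d" "X = Metric_space.mtopology M d"
    using assms(1) unfolding C_compactum_def metrizable_space_def by blast
  interpret X: Metric_space M d by (rule M)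
  obtain N dY where N: "Metric_space N dY" "Y = Metric_space.mtopology N dY"
    using assms(2) unfolding C_compactum_def metrizable_space_def by blast
  interpret Y: Metric_space N dY by (rule N)
  have cX: "compact_space X.mtopology" using assms(1) M(2) by (simp add: C_compactum_def)
  have cY: "compact_space Y" using assms(2) by (simp add: C_compactum_def)
  have tX: "topspace X = M" and tY: "topspace Y = N" using M(2) N(2) by simp_all
  have f: "continuous_map X.mtopology Y f" using assms(3) M(2) by (simp add: dimensional_map_def)
  have fN: "f x \<in> N" if "x \<in> M" for x
    using continuous_map_image_subset_topspace[OF f] that tY by auto
  have fibres: "covering_dim_le (subtopology X.mtopology {x \<in> M. f x = y}) (int k)" if y: "y \<in> topspace Y" for y
  proof (rule covering_dim_le_of_nat)
    have "covering_dim (subtopology X {x \<in> M. f x = y}) \<le> ereal (real k)"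
      using assms(3) y unfolding dimensional_map_def tX by blast
    then show "covering_dim (subtopology X.mtopology {x \<in> M. f x = y}) \<le> ereal (real k)"
      by (simp only: M(2))
  qed
  have "open_cover X.mtopology \<omega>X" using assms(4) M(2) by simp
  then obtain \<rho> where \<rho>: "\<rho> > 0" "\<And>x. x \<in> M \<Longrightarrow> \<exists>U\<in>\<omega>X. X.mball x \<rho> \<subseteq> U"
    using X.lebesgue_open_cover[OF cX] by blast
  define e where "e = \<rho> / 2"
  have e: "0 < e" "e < \<rho>" using \<rho>(1) by (simp_all add: e_def)
  obtain r G \<O> where r: "0 < r" and \<O>: "open_cover Y \<O>"
    and G: "\<And>i. i \<le> k \<Longrightarrow> openin X.mtopology (G i)" "M \<subseteq> (\<Union>i\<le>k. G i)"
    and fine: "\<And>P i. \<lbrakk>P \<in> \<O>; i \<le> k\<rbrakk> \<Longrightarrow> chain_fine d r e ({x \<in> M. f x \<in> P} \<inter> G i)"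
    by (rule X.fine_decomposition[OF cX f assms(2) fibres e(1)]) blast+
  \<comment> \<open>a cover fine enough for both the decomposition and \<open>\<omega>Y\<close>, and of the order allowed by \<open>dim Y\<close>\<close>
  obtain \<V> where \<V>: "finite \<V>" "open_cover Y \<V>" "cover_refines \<V> {U \<inter> V | U V. U \<in> \<O> \<and> V \<in> \<omega>Y}"
    and ord: "\<And>n. covering_dim Y = ereal (real n) \<Longrightarrow> \<forall>y\<in>topspace Y. card {V \<in> \<V>. y \<in> V} \<le> n + 1"
    by (rule finite_refinement_of_small_order[OF cY open_cover_Int[OF \<O> assms(5)]]) blast+
  obtain V where "bij_betw V {0..<card \<V>} \<V>"
    using ex_bij_betw_nat_finite[OF \<V>(1)] by blast
  moreover define m where "m = card \<V>"
  ultimately have V: "bij_betw V {..<m} \<V>" by (simp add: atLeast0LessThan)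
  have V_in: "V v \<in> \<V>" if "v < m" for v using V that by (auto simp: bij_betw_def)
  have V_open: "openin Y (V v)" if "v < m" for v
    using V_in[OF that] \<V>(2) unfolding open_cover_def by blast
  have V_sub: "\<exists>P\<in>\<O>. \<exists>W\<in>\<omega>Y. V v \<subseteq> P \<inter> W" if v: "v < m" for v
  proof -
    obtain Q where "Q \<in> {U \<inter> V | U V. U \<in> \<O> \<and> V \<in> \<omega>Y}" "V v \<subseteq> Q"
      using \<V>(3) V_in[OF v] unfolding cover_refines_def by meson
    then show ?thesis by blast
  qed
  have V_open': "openin Y.mtopology (V v)" if "v \<in> {..<m}" for v using V_open that N(2) by simp
  have V_cover: "N \<subseteq> (\<Union>v\<in>{..<m}. V v)"
    using \<V>(2) V tY unfolding open_cover_def bij_betw_def by simp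
  obtain \<phi> where \<phi>: "\<And>v. v \<in> {..<m} \<Longrightarrow> continuous_map Y.mtopology euclideanreal (\<phi> v)"
    "\<And>v y. 0 \<le> \<phi> v y" "\<And>y. y \<in> N \<Longrightarrow> (\<Sum>v<m. \<phi> v y) = 1"
    "\<And>v y. \<lbrakk>v \<in> {..<m}; y \<in> N; 0 < \<phi> v y\<rbrakk> \<Longrightarrow> y \<in> V v"
    using Y.partition_of_unity[OF finite_lessThan V_open' V_cover] by blast
  define A where "A v = {x \<in> topspace X.mtopology. f x \<in> V v}" for v
  obtain I :: "nat set" and \<pi> :: "nat \<Rightarrow> nat" and \<psi> where I: "finite I" "\<pi> ` I \<subseteq> {..<m}"
    and \<psi>: "\<And>w. w \<in> I \<Longrightarrow> continuous_map X.mtopology euclideanreal (\<psi> w)"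
      "\<And>w x. \<lbrakk>w \<in> I; x \<in> M\<rbrakk> \<Longrightarrow> 0 \<le> \<psi> w x"
      "\<And>v x. \<lbrakk>v < m; x \<in> M\<rbrakk> \<Longrightarrow> (\<Sum>w\<in>{w \<in> I. \<pi> w = v}. \<psi> w x) = \<phi> v (f x)"
      "\<And>w x y. \<lbrakk>w \<in> I; 0 < \<psi> w x; 0 < \<psi> w y\<rbrakk> \<Longrightarrow> d x y \<le> e" "\<And>w. w \<in> I \<Longrightarrow> M \<noteq> {}"
      "\<And>x S. \<lbrakk>x \<in> M; S \<subseteq> {w \<in> I. 0 < \<psi> w x}\<rbrakk> \<Longrightarrow> card S \<le> k + card (\<pi> ` S)"
  proof (rule X.refined_partition_of_unity[OF cX r, where A=A and a="\<lambda>v x. \<phi> v (f x)" and G=G and m=m and k=k and e=e])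
    show "openin X.mtopology (A v)" if "v < m" for v
      unfolding A_def by (rule openin_continuous_map_preimage[OF f V_open[OF that]])
    show "continuous_map X.mtopology euclideanreal (\<lambda>x. \<phi> v (f x))" if "v < m" for v
      using continuous_map_compose[OF f, of euclideanreal "\<phi> v"] \<phi>(1)[of v] that N(2) by (simp add: comp_def)
    show "(\<Sum>v<m. \<phi> v (f x)) = 1" if "x \<in> M" for x using \<phi>(3)[OF fN[OF that]] .
    show "x \<in> A v" if "v < m" "x \<in> M" "0 < \<phi> v (f x)" for v x
      using \<phi>(4)[of v "f x"] that fN by (simp add: A_def)
    show "chain_fine d r e (A v \<inter> G i)" if vi: "v < m" "i \<le> k" for v i
    proof -
      obtain P where P: "P \<in> \<O>" "V v \<subseteq> P" using V_sub[OF vi(1)] by blast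
      show ?thesis
        by (rule chain_fine_mono[OF fine[OF P(1) vi(2)]]) (use P(2) in \<open>auto simp: A_def\<close>)
    qed
  qed (use \<phi>(2) G that in auto)
  have small: "\<exists>W\<in>\<omega>X. {x \<in> topspace X. 0 < \<psi> w x} \<subseteq> W" if w: "w \<in> I" for w
  proof -
    have "\<exists>x\<in>M. {x \<in> topspace X. 0 < \<psi> w x} \<subseteq> X.mball x \<rho>"
    proof (cases "\<exists>x\<in>M. 0 < \<psi> w x")
      case True
      then obtain x where x: "x \<in> M" "0 < \<psi> w x" by blast
      have "d x y < \<rho>" if "0 < \<psi> w y" for y using \<psi>(4)[OF w x(2) that] e(2) by simp
      then have "{x \<in> topspace X. 0 < \<psi> w x} \<subseteq> X.mball x \<rho>"
        unfolding tX using x(1) by (simp add: subset_iff)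
      then show ?thesis using x(1) by blast
    next
      case False
      then have "{x \<in> topspace X. 0 < \<psi> w x} = {}" unfolding tX by simp
      then show ?thesis using \<psi>(5)[OF w] by (simp only: ex_in_conv[symmetric]) blast
    qed
    then obtain x where "x \<in> M" "{x \<in> topspace X. 0 < \<psi> w x} \<subseteq> X.mball x \<rho>" by blast
    moreover obtain W where "W \<in> \<omega>X" "X.mball x \<rho> \<subseteq> W" using \<rho>(2)[OF \<open>x \<in> M\<close>] by blast
    ultimately show ?thesis by (meson order_trans)
  qed
  have smallY: "\<exists>W\<in>\<omega>Y. {y \<in> topspace Y. 0 < \<phi> v y} \<subseteq> W" if v: "v \<in> {..<m}" for v
  proof -
    obtain W where W: "W \<in> \<omega>Y" "V v \<subseteq> W" using V_sub v by blast
    have "{y \<in> topspace Y. 0 < \<phi> v y} \<subseteq> W" unfolding tY using \<phi>(4)[OF v] W(2) by blast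
    then show ?thesis using W(1) by blast
  qed
  have card: "card S \<le> k + card (\<pi> ` S)" if S: "S \<in> nerve X I \<psi>" for S
  proof -
    obtain x where "x \<in> M" "S \<subseteq> {w \<in> I. 0 < \<psi> w x}" using S unfolding nerve_def tX by blast
    then show ?thesis by (rule \<psi>(6))
  qed
  note approx = simplicial_approximation_of_partitions[of X f Y I "{..<m}" \<pi> \<phi> \<omega>Y \<psi> \<omega>X k,
      unfolded tX tY, OF fN I(1) finite_lessThan I(2) \<phi>(1)[folded N(2)] \<phi>(2) \<phi>(3) smallY[unfolded tY]
        \<psi>(1)[folded M(2)] \<psi>(2) small[unfolded tX] _ card]
  let ?K = "std_simplex ` nerve X I \<psi>" and ?L = "std_simplex ` nerve Y {..<m} \<phi>"
  have approx1: "finite_complex ?K \<and> finite_complex ?L \<and>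
    cover_map \<omega>X X (polyhedron_of ?K) (nerve_map I \<psi>) \<and> cover_map \<omega>Y Y (polyhedron_of ?L) (nerve_map {..<m} \<phi>) \<and>
    simplicial_map_on ?K ?L (vertex_map \<pi> I) \<and>
    dimensional_map k (polyhedron_of ?K) (polyhedron_of ?L) (vertex_map \<pi> I) \<and>
    (\<forall>x\<in>topspace X. vertex_map \<pi> I (nerve_map I \<psi> x) = nerve_map {..<m} \<phi> (f x))"
    unfolding tX using approx(1) \<psi>(3) by simp
  have im: "\<pi> ` S \<in> nerve Y {..<m} \<phi>" if "S \<in> nerve X I \<psi>" for S
    using approx(2) \<psi>(3) that by simp
  have dims: "covering_dim (polyhedron_of ?L) \<le> covering_dim Y \<and>
    covering_dim (polyhedron_of ?K) \<le> covering_dim Y + ereal (real k)"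
  proof (rule covering_dim_cases[OF False])
    assume "covering_dim Y = \<infinity>"
    then show ?thesis by simp
  next
    fix n assume n: "covering_dim Y = ereal (real n)"
    have cardY: "card S \<le> n + 1" if S: "S \<in> nerve Y {..<m} \<phi>" for S
    proof -
      obtain y where y: "y \<in> N" "S \<subseteq> {v \<in> {..<m}. 0 < \<phi> v y}"
        using S unfolding nerve_def tY by blast
      have "V ` S \<subseteq> {V \<in> \<V>. y \<in> V}" using y \<phi>(4) V_in by auto
      moreover have "inj_on V S"
        using bij_betw_imp_inj_on[OF V] by (rule inj_on_subset) (use y(2) in auto)
      ultimately have "card S \<le> card {V \<in> \<V>. y \<in> V}" using \<V>(1) by (intro card_inj_on_le) auto
      also have "\<dots> \<le> n + 1" using ord[OF n] y(1) tY by simp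
      finally show ?thesis .
    qed
    have cardX: "card S \<le> (n + k) + 1" if S: "S \<in> nerve X I \<psi>" for S
      using card[OF S] cardY[OF im[OF S]] by linarith
    have "covering_dim (polyhedron_of ?K) \<le> ereal (real (n + k))"
      by (rule covering_dim_polyhedron[OF I(1) finite_nerve[OF I(1)]]) (erule nerve_subset cardX)+
    moreover have "covering_dim (polyhedron_of ?L) \<le> ereal (real n)"
      by (rule covering_dim_polyhedron[OF finite_lessThan finite_nerve[OF finite_lessThan]]) (erule nerve_subset cardY)+
    ultimately show ?thesis using n by simp
  qed
  show ?thesis
    by (rule exI[of _ ?K], rule exI[of _ ?L], rule exI[of _ "nerve_map I \<psi>"],
        rule exI[of _ "nerve_map {..<m} \<phi>"], rule exI[of _ "vertex_map \<pi> I"])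
      (use approx1 dims in simp)
qed

end
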